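(* Let $m,n\ge 2$ be integers and let $\phi: M_{mn}\rightarrow M_{mn}$ be a (complex-)linear map. The following are equivalent. (a) $W(\phi(A\otimes B)) = W(A\otimes B)$ for all $A\in M_m$ and $B\in M_n$. (b) There exist a unitary matrix $U\in M_{mn}$ and maps $\varphi_1: M_m\to M_m$, $\varphi_2: M_n\to M_n$, each of which is either the identity map $X\mapsto X$ or the transposition map $X\mapsto X^t$, such that $$\phi(A\otimes B) = U(\varphi_1(A)\otimes \varphi_2(B))U^* \quad\text{for all } A\in M_m \text{ and } B\in M_n,$$ and, if both $m\ge 3$ and $n\ge 3$, the maps $\varphi_1$ and $\varphi_2$ are of the same type (both the identity map or both the transposition map).
   Context: $M_k$ denotes the set of $k\times k$ complex matrices. $A\otimes B\in M_{mn}$ is the tensor (Kronecker) product of $A\in M_m$ and $B\in M_n$. $X^t$ is the transpose and $X^*$ the conjugate transpose of $X$. For $A\in M_k$, the numerical range is $W(A)=\{u^*Au : u\in\mathbb{C}^k,\ u^*u=1\}\subseteq\mathbb{C}$. *)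

theory Defs
  imports "HOL-Analysis.Analysis"
begin

text \<open>
  The space of complex matrices of size \<open>CARD('k)\<close> is \<^typ>\<open>complex ^ 'k ^ 'k\<close>.  The rows and
  columns of a matrix of size \<open>m n\<close> are indexed by pairs in \<^typ>\<open>'m \<times> 'n\<close>; the usual
  numbering of the entries of a Kronecker product is the lexicographic enumeration of these pairs.
\<close>

definition kronecker_product ::
    "complex ^ 'm ^ 'm \<Rightarrow> complex ^ 'n ^ 'n \<Rightarrow> complex ^ ('m \<times> 'n) ^ ('m \<times> 'n)"
    (infixl "\<otimes>" 70)
  where "A \<otimes> B = (\<chi> p q. A $ fst p $ fst q * B $ snd p $ snd q)"

definition conj_transpose :: "complex ^ 'k ^ 'l \<Rightarrow> complex ^ 'l ^ 'k"
  where "conj_transpose A = map_matrix cnj (transpose A)"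

definition unitary_matrix :: "complex ^ 'k ^ 'k \<Rightarrow> bool"
  where "unitary_matrix U \<longleftrightarrow> U ** conj_transpose U = mat 1 \<and> conj_transpose U ** U = mat 1"

text \<open>The inner product is conjugate-linear in the first argument: \<open>cinner u v = u\<^sup>* v\<close>.\<close>

definition cinner :: "complex ^ 'k \<Rightarrow> complex ^ 'k \<Rightarrow> complex"
  where "cinner u v = (\<Sum>i\<in>UNIV. cnj (u $ i) * v $ i)"

definition numerical_range :: "complex ^ 'k ^ 'k \<Rightarrow> complex set"
  where "numerical_range A = {cinner u (A *v u) | u. cinner u u = 1}"

text \<open>
  Neither \<open>*\<^sub>R\<close> nor \<open>*s\<close> multiplies a matrix by a complex scalar: on matrices, the scalars of
  \<open>*s\<close> are row vectors.
\<close>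

definition scale_matrix :: "complex \<Rightarrow> complex ^ 'k ^ 'l \<Rightarrow> complex ^ 'k ^ 'l"
  where "scale_matrix c A = map_matrix (\<lambda>x. c * x) A"

lemma vector_space_scale_matrix: "vector_space scale_matrix"
  by unfold_locales (simp_all add: scale_matrix_def vec_eq_iff algebra_simps)

text \<open>The unqualified \<open>linear\<close> is linearity over the reals.\<close>

abbreviation complex_linear :: "(complex ^ 'k ^ 'k \<Rightarrow> complex ^ 'l ^ 'l) \<Rightarrow> bool"
  where "complex_linear \<equiv> Vector_Spaces.linear scale_matrix scale_matrix"

lemma complex_linear_iff:
  "complex_linear f \<longleftrightarrow>
     (\<forall>X Y. f (X + Y) = f X + f Y) \<and> (\<forall>c X. f (scale_matrix c X) = scale_matrix c (f X))"
  by (simp add: Vector_Spaces.linear_iff vector_space_scale_matrix)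

end

theory Submission
  imports Defs
begin

text \<open>
  The rank-one projections \<open>x x\<^sup>*\<close>, with \<open>x\<close> a unit vector, span the space of matrices, so a
  linear map is determined by its values at them. The theorem is proved by showing that \<open>\<phi>\<close>
  sends the product projections \<open>x x\<^sup>* \<otimes> y y\<^sup>*\<close> to rank-one projections, and by solving this
  linear preserver problem.

  The numerical range of \<open>x x\<^sup>* \<otimes> y y\<^sup>*\<close> is contained in \<open>[0, 1]\<close> and contains \<open>1\<close>; hence its
  image is positive semidefinite and its form takes the value \<open>1\<close> at some unit vector. If \<open>x\<close>
  and \<open>y\<close> run through orthonormal bases, there are \<open>m n\<close> such images, they add up to \<open>\<phi> 1 = 1\<close>,
  and in dimension \<open>m n\<close> this leaves room only for rank-one projections
  (\<open>resolution_into_rank_one_projections\<close>). Orthogonal projections that share a factor have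
  orthogonal images, because the numerical range of their sum lies in \<open>[0, 1]\<close>.

  A linear map of matrices that preserves rank-one projections and their orthogonality has the
  form \<open>A \<mapsto> V A V\<^sup>*\<close> or \<open>A \<mapsto> V A\<^sup>t V\<^sup>*\<close> (\<open>projection_preserving_form\<close>). Fix a unit vector \<open>f\<close>.
  After transposing the first factor if necessary, \<open>\<phi> (x x\<^sup>* \<otimes> f f\<^sup>*) = (V x) (V x)\<^sup>*\<close> with \<open>V\<close>
  linear. For each unit vector \<open>x\<close> the map \<open>B \<mapsto> \<phi> (x x\<^sup>* \<otimes> B)\<close> also has one of the two forms,
  and since the unit sphere is connected it is the same form for all \<open>x\<close>; after transposing the
  second factor if necessary, it is the first (\<open>congruence_if_left_linear\<close>). Then
  \<open>\<phi> (x x\<^sup>* \<otimes> y y\<^sup>*) = g g\<^sup>*\<close> with \<open>g = \<phi> (x x\<^sup>* \<otimes> y f\<^sup>*) (V x)\<close>, and this vector is in fact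
  \<open>\<phi> (1 \<otimes> y f\<^sup>*) (V x)\<close>, which is bilinear in \<open>x\<close> and \<open>y\<close> (\<open>congruence_if_both_linear\<close>). So
  \<open>g = U (x \<otimes> y)\<close> for a matrix \<open>U\<close>, and \<open>U U\<^sup>* = \<phi> 1 = 1\<close>.

  It remains to see which transpositions preserve numerical ranges. Unitary congruence and the
  full transposition do. If one factor has size \<open>2\<close>, so does the transposition of a single
  factor, because every \<open>2 \<times> 2\<close> matrix is unitarily similar to its transpose
  (\<open>two_by_two_unitarily_similar_transpose\<close>). If both sizes are at least \<open>3\<close>, the transposition
  of a single factor changes the numerical range of a product of two weighted shifts
  (\<open>kronecker_partial_transpose_range_differs\<close>).
\<close>

section \<open>Rank-one matrices and Kronecker products\<close>

text \<open>
  The rank-one matrix \<open>u v\<^sup>*\<close>; for a unit vector \<open>u\<close>, \<open>outer u u\<close> is the orthogonal projection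
  onto the line of \<open>u\<close>.
\<close>

definition outer :: "complex ^ 'm \<Rightarrow> complex ^ 'n \<Rightarrow> complex ^ 'n ^ 'm"
  where "outer u v = (\<chi> i j. u $ i * cnj (v $ j))"

definition cnj_vec :: "complex ^ 'n \<Rightarrow> complex ^ 'n"
  where "cnj_vec x = (\<chi> i. cnj (x $ i))"

definition tensor_vec :: "complex ^ 'm \<Rightarrow> complex ^ 'n \<Rightarrow> complex ^ ('m \<times> 'n)"
  where "tensor_vec x y = (\<chi> p. x $ fst p * y $ snd p)"

lemma cinner_add_right: "cinner u (v + w) = cinner u v + cinner u w"
  and cinner_add_left: "cinner (u + v) w = cinner u w + cinner v w"
  and cinner_diff_right: "cinner u (v - w) = cinner u v - cinner u w"
  and cinner_diff_left: "cinner (u - v) w = cinner u w - cinner v w"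
  and cinner_scale_right: "cinner u (c *s v) = c * cinner u v"
  and cinner_scale_left: "cinner (c *s u) v = cnj c * cinner u v"
  and cinner_zero_right [simp]: "cinner u 0 = 0"
  and cinner_zero_left [simp]: "cinner 0 u = 0"
  and cinner_minus_right: "cinner u (- v) = - cinner u v"
  and cinner_minus_left: "cinner (- u) v = - cinner u v"
  by (simp_all add: cinner_def algebra_simps sum.distrib sum_subtractf sum_distrib_left sum_negf)

lemmas cinner_simps = cinner_add_right cinner_add_left cinner_diff_right cinner_diff_left
  cinner_scale_right cinner_scale_left cinner_minus_right cinner_minus_left

lemma cnj_cinner: "cnj (cinner u v) = cinner v u"
  by (simp add: cinner_def mult.commute)

lemma cinner_self: "cinner u u = complex_of_real ((norm u)\<^sup>2)"
proof -
  have "cinner u u = (\<Sum>i\<in>UNIV. complex_of_real ((cmod (u $ i))\<^sup>2))"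
    unfolding cinner_def by (intro sum.cong refl) (metis complex_norm_square mult.commute)
  also have "\<dots> = complex_of_real ((norm u)\<^sup>2)"
    by (simp add: norm_vec_def L2_set_def sum_nonneg)
  finally show ?thesis .
qed

lemma cinner_self_eq_1_iff: "cinner u u = 1 \<longleftrightarrow> norm u = 1"
proof -
  have "cinner u u = 1 \<longleftrightarrow> complex_of_real ((norm u)\<^sup>2) = complex_of_real 1"
    by (simp only: cinner_self of_real_1)
  also have "\<dots> \<longleftrightarrow> norm u = 1"
    by (simp only: of_real_eq_iff) (simp add: power2_eq_1_iff,
      metis norm_ge_zero zero_neq_neg_one not_one_le_zero neg_0_le_iff_le)
  finally show ?thesis .
qed

lemma cinner_self_eq_0_iff [simp]: "cinner u u = 0 \<longleftrightarrow> u = 0"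
  by (simp add: cinner_self)

lemma cinner_axis_left: "cinner (axis i 1) v = v $ i"
  and cinner_axis_right: "cinner v (axis i 1) = cnj (v $ i)"
  by (simp_all add: cinner_def axis_def if_distrib [where f = cnj] if_distribR if_distrib [where f =
    "\<lambda>x. x * _"]
      if_distrib [where f = "\<lambda>x. _ * x"] cong: if_cong)

lemma cinner_axis_axis: "cinner (axis i 1) (axis j 1) = (if i = j then 1 else 0)"
  unfolding cinner_axis_left by (simp add: axis_def)

lemma eq_zero_if_cinner_eq_zero: "(\<And>u. cinner u v = 0) \<Longrightarrow> v = 0"
  using cinner_self_eq_0_iff by blast

lemma conj_transpose_conj_transpose [simp]: "conj_transpose (conj_transpose A) = A"
  and conj_transpose_component: "conj_transpose A $ i $ j = cnj (A $ j $ i)"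
  by (simp_all add: conj_transpose_def map_matrix_def transpose_def vec_eq_iff)

lemma conj_transpose_mat_1: "conj_transpose (mat 1) = mat 1"
  by (auto simp: vec_eq_iff conj_transpose_component mat_def)

lemma cinner_conj_transpose: "cinner u (A *v w) = cinner (conj_transpose A *v u) w"
proof -
  have "cinner u (A *v w) = (\<Sum>i\<in>UNIV. \<Sum>j\<in>UNIV. cnj (u $ i) * (A $ i $ j * w $ j))"
    by (simp add: cinner_def matrix_vector_mult_def sum_distrib_left)
  also have "\<dots> = (\<Sum>j\<in>UNIV. \<Sum>i\<in>UNIV. cnj (u $ i) * (A $ i $ j * w $ j))"
    by (rule sum.swap)
  also have "\<dots> = cinner (conj_transpose A *v u) w"
    by (simp add: cinner_def matrix_vector_mult_def sum_distrib_left sum_distrib_right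
        conj_transpose_component mult_ac)
  finally show ?thesis .
qed

lemma exists_unit_multiple:
  assumes "x \<noteq> (0 :: complex ^ 'n)"
  obtains c u where "c \<noteq> 0" "cinner u u = 1" "x = c *s u"
proof
  let ?u = "complex_of_real (1 / norm x) *s x"
  show "complex_of_real (norm x) \<noteq> 0" using assms by simp
  show "cinner ?u ?u = 1"
    using assms unfolding cinner_simps by (simp add: cinner_self power2_eq_square)
  show "x = complex_of_real (norm x) *s ?u"
    using assms by (simp add: vector_smult_assoc)
qed

lemma scale_matrix_mult_vec: "scale_matrix c A *v u = c *s (A *v u)"
  by (simp add: vec_eq_iff scale_matrix_def map_matrix_def matrix_vector_mult_def
      sum_distrib_left mult.assoc)

lemma scale_matrix_mult: "scale_matrix c A ** scale_matrix d B = scale_matrix (c * d) (A ** B)"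
  by (simp add: scale_matrix_def map_matrix_def vec_eq_iff matrix_matrix_mult_def
      sum_distrib_left mult_ac)

lemma scale_matrix_simps:
  "scale_matrix c (A + B) = scale_matrix c A + scale_matrix c B"
  "scale_matrix c (A - B) = scale_matrix c A - scale_matrix c B"
  "scale_matrix c (- A) = - scale_matrix c A"
  "scale_matrix (c + d) A = scale_matrix c A + scale_matrix d A"
  "scale_matrix c (scale_matrix d A) = scale_matrix (c * d) A"
  "scale_matrix 1 A = A" "scale_matrix 0 A = 0" "scale_matrix c 0 = 0" "scale_matrix (-1) A = - A"
  by (simp_all add: scale_matrix_def map_matrix_def vec_eq_iff algebra_simps)

lemma scale_matrix_eq_0_iff: "scale_matrix c A = 0 \<longleftrightarrow> c = 0 \<or> A = 0"
  by (auto simp: scale_matrix_def map_matrix_def vec_eq_iff)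

lemma matrix_mult_add_rdistrib: "(A + B) ** C = A ** C + B ** C"
  for A B :: "complex ^ 'm ^ 'n"
  by (simp add: matrix_matrix_mult_def vec_eq_iff distrib_right sum.distrib)

lemma matrix_sum_vector_mult: "(\<Sum>i\<in>I. A i) *v u = (\<Sum>i\<in>I. A i *v u)"
  by (induction I rule: infinite_finite_induct) (simp_all add: matrix_vector_mult_add_rdistrib)

lemma matrix_vector_mult_sum_basis:
  "A *v u = (\<Sum>i\<in>UNIV. u $ i *s (A *v axis i 1))" for A :: "complex ^ 'm ^ 'n"
proof -
  have "u = (\<Sum>i\<in>UNIV. u $ i *s axis i 1)"
    by (simp add: vec_eq_iff axis_def if_distrib [where f = "\<lambda>x. _ * x"] cong: if_cong)
  then have "A *v u = A *v (\<Sum>i\<in>UNIV. u $ i *s axis i 1)" by simp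
  then show ?thesis by (simp only: vec.sum vec.scale)
qed

lemma outer_mult_vec: "outer u v *v w = cinner v w *s u"
  by (simp add: outer_def cinner_def matrix_vector_mult_def vec_eq_iff sum_distrib_left mult_ac)

lemma outer_mult_outer: "outer u v ** outer w x = scale_matrix (cinner v w) (outer u x)"
  by (simp add: outer_def cinner_def matrix_matrix_mult_def vec_eq_iff sum_distrib_left
      scale_matrix_def map_matrix_def sum_distrib_right mult_ac)

lemma mult_outer: "A ** outer u v = outer (A *v u) v"
  by (simp add: outer_def matrix_vector_mult_def matrix_matrix_mult_def vec_eq_iff
      sum_distrib_left sum_distrib_right mult_ac)

lemma outer_mult: "outer u v ** conj_transpose A = outer u (A *v v)"
  by (simp add: outer_def matrix_vector_mult_def matrix_matrix_mult_def vec_eq_iff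
      conj_transpose_component sum_distrib_left mult_ac)

lemma outer_add_left: "outer (u + v) w = outer u w + outer v w"
  and outer_add_right: "outer u (v + w) = outer u v + outer u w"
  and outer_diff_left: "outer (u - v) w = outer u w - outer v w"
  and outer_diff_right: "outer u (v - w) = outer u v - outer u w"
  and outer_minus_left: "outer (- u) w = - outer u w"
  and outer_minus_right: "outer u (- w) = - outer u w"
  and outer_zero_left [simp]: "outer 0 w = 0"
  and outer_zero_right [simp]: "outer u 0 = 0"
  and outer_scale_left: "outer (c *s u) w = scale_matrix c (outer u w)"
  and outer_scale_right: "outer u (c *s w) = scale_matrix (cnj c) (outer u w)"
  by (simp_all add: outer_def vec_eq_iff algebra_simps scale_matrix_def map_matrix_def)

lemmas outer_simps = outer_add_left outer_add_right outer_diff_left outer_diff_right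
  outer_minus_left outer_minus_right outer_scale_left outer_scale_right

lemma outer_eq_0_iff: "outer u v = 0 \<longleftrightarrow> u = 0 \<or> v = 0"
  by (auto simp: outer_def vec_eq_iff)

lemma outer_scale_self: "outer (c *s u) (c *s u) = scale_matrix (c * cnj c) (outer u u)"
  by (simp add: outer_simps scale_matrix_simps mult.commute)

lemma norm_eq_if_outer_self_eq:
  fixes a b :: "complex ^ 'n"
  assumes "outer a a = outer b b" shows "norm a = norm b"
proof -
  have "cinner a a = (\<Sum>i\<in>UNIV. outer a a $ i $ i)" for a :: "complex ^ 'n"
    by (simp add: outer_def cinner_def mult.commute)
  from this [of a] this [of b] have "cinner a a = cinner b b" using assms by simp
  then have "complex_of_real ((norm a)\<^sup>2) = complex_of_real ((norm b)\<^sup>2)"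
    by (simp only: cinner_self)
  then show ?thesis by (simp only: of_real_eq_iff power2_eq_iff_nonneg norm_ge_zero)
qed

lemma transpose_outer: "transpose (outer u v) = outer (cnj_vec v) (cnj_vec u)"
  by (simp add: transpose_def outer_def cnj_vec_def vec_eq_iff mult.commute)

lemma cinner_cnj_vec: "cinner (cnj_vec x) (cnj_vec y) = cinner y x"
  by (simp add: cinner_def cnj_vec_def mult.commute)

lemma sum_UNIV_prod: "(\<Sum>p\<in>(UNIV :: ('a::finite \<times> 'b::finite) set). f p) =
  (\<Sum>i\<in>UNIV. \<Sum>j\<in>UNIV. f (i, j))"
  by (simp add: sum.cartesian_product UNIV_Times_UNIV [symmetric] del: UNIV_Times_UNIV)

lemma kronecker_outer: "outer u v \<otimes> outer x y = outer (tensor_vec u x) (tensor_vec v y)"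
  by (simp add: kronecker_product_def outer_def tensor_vec_def vec_eq_iff)

lemma cinner_tensor: "cinner (tensor_vec u x) (tensor_vec v y) = cinner u v * cinner x y"
  by (simp add: cinner_def tensor_vec_def sum_UNIV_prod sum_product mult_ac)

lemma kronecker_mult: "(A \<otimes> B) ** (C \<otimes> D) = (A ** C) \<otimes> (B ** D)"
  by (simp add: kronecker_product_def matrix_matrix_mult_def vec_eq_iff sum_UNIV_prod sum_product
    mult_ac)

lemma conj_transpose_kronecker: "conj_transpose (A \<otimes> B) = conj_transpose A \<otimes> conj_transpose B"
  by (simp add: kronecker_product_def vec_eq_iff conj_transpose_component)

lemma transpose_kronecker: "transpose (A \<otimes> B) = transpose A \<otimes> transpose B"
  by (simp add: kronecker_product_def vec_eq_iff transpose_def)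

lemma kronecker_mat_1: "mat 1 \<otimes> mat 1 = mat 1"
  by (auto simp: kronecker_product_def vec_eq_iff mat_def prod_eq_iff)

lemma kronecker_simps:
  "(A + B) \<otimes> C = A \<otimes> C + B \<otimes> C"
  "A \<otimes> (C + D) = A \<otimes> C + A \<otimes> D"
  "scale_matrix c A \<otimes> C = scale_matrix c (A \<otimes> C)"
  "A \<otimes> scale_matrix c C = scale_matrix c (A \<otimes> C)"
  by (simp_all add: kronecker_product_def vec_eq_iff scale_matrix_def map_matrix_def algebra_simps)

section \<open>Complex-linear maps between spaces of matrices\<close>

lemma complex_linear_add: "complex_linear T \<Longrightarrow> T (X + Y) = T X + T Y"
  and complex_linear_scale: "complex_linear T \<Longrightarrow> T (scale_matrix c X) = scale_matrix c (T X)"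
  by (simp_all add: complex_linear_iff)

lemma complex_linear_minus: "complex_linear T \<Longrightarrow> T (- X) = - T X"
  using complex_linear_scale [of T "-1" X] by (simp add: scale_matrix_simps)

lemma complex_linear_diff: "complex_linear T \<Longrightarrow> T (X - Y) = T X - T Y"
  using complex_linear_add [of T X "- Y"] by (simp add: complex_linear_minus)

lemma complex_linear_zero: "complex_linear T \<Longrightarrow> T 0 = 0"
  using complex_linear_scale [of T 0 0] by (simp add: scale_matrix_simps)

lemma complex_linear_sum: "complex_linear T \<Longrightarrow> T (\<Sum>i\<in>I. X i) = (\<Sum>i\<in>I. T (X i))"
  by (induction I rule: infinite_finite_induct)
     (simp_all add: complex_linear_add complex_linear_zero)

lemmas complex_linear_simps = complex_linear_add complex_linear_scale complex_linear_minus
  complex_linear_diff complex_linear_zero complex_linear_sum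

lemma complex_linear_transpose:
  fixes T :: "complex ^ 'm ^ 'm \<Rightarrow> complex ^ 'k ^ 'k"
  assumes "complex_linear T"
  shows "complex_linear (\<lambda>A. T (transpose A))"
proof -
  have "transpose (X + Y) = transpose X + transpose Y"
    "transpose (scale_matrix c X) = scale_matrix c (transpose X)"
    for X Y :: "complex ^ 'm ^ 'm" and c
    by (simp_all add: transpose_def vec_eq_iff scale_matrix_def map_matrix_def)
  then show ?thesis using assms by (simp add: complex_linear_iff)
qed

lemma complex_linear_congruence: "complex_linear (\<lambda>A. U ** A ** conj_transpose U)"
proof -
  have "U ** scale_matrix c A ** conj_transpose U = scale_matrix c (U ** A ** conj_transpose U)"
    for c A
    using scale_matrix_mult [of 1 U c A] scale_matrix_mult [of c "U ** A" 1 "conj_transpose U"]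
    by (simp add: scale_matrix_simps)
  then show ?thesis
    by (simp add: complex_linear_iff matrix_add_ldistrib matrix_mult_add_rdistrib)
qed

lemma complex_linear_imp_linear:
  assumes "complex_linear T" shows "linear T"
proof (rule linearI)
  have *: "r *\<^sub>R X = scale_matrix (complex_of_real r) X" for r and X :: "complex ^ 'x ^ 'x"
    by (simp add: vec_eq_iff scale_matrix_def map_matrix_def) (simp add: scaleR_conv_of_real)
  show "T (X + Y) = T X + T Y" for X Y by (rule complex_linear_add [OF assms])
  show "T (r *\<^sub>R X) = r *\<^sub>R T X" for r X
    unfolding * by (rule complex_linear_scale [OF assms])
qed

lemma matrix_eq_sum_outer:
  "A = (\<Sum>i\<in>UNIV. \<Sum>j\<in>UNIV. scale_matrix (A $ i $ j) (outer (axis i 1) (axis j 1)))"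
  by (simp add: vec_eq_iff outer_def scale_matrix_def map_matrix_def axis_def if_distrib [where f =
    cnj] if_distrib [where f = "\<lambda>x. x * _"]
      if_distrib [where f = "\<lambda>x. _ * x"] cong: if_cong)

text \<open>
  Polarization is what reduces every statement about linear maps of matrices to rank-one
  projections.
\<close>

lemma complex_linear_polarization:
  assumes "complex_linear T"
  shows "T (outer x y) = scale_matrix (1/4) (T (outer (x + y) (x + y)) - T (outer (x - y) (x - y))
    + scale_matrix \<i> (T (outer (x + \<i> *s y) (x + \<i> *s y)) - T (outer (x - \<i> *s y) (x - \<i> *s y))))"
proof -
  have "outer x y = scale_matrix (1/4) (outer (x + y) (x + y) - outer (x - y) (x - y)
    + scale_matrix \<i> (outer (x + \<i> *s y) (x + \<i> *s y) - outer (x - \<i> *s y) (x - \<i> *s y)))"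
    by (simp add: vec_eq_iff outer_def scale_matrix_def map_matrix_def field_simps)
  from arg_cong [OF this, of T] show ?thesis
    by (simp only: complex_linear_simps [OF assms])
qed

lemma complex_linear_eqI:
  assumes "complex_linear T" "complex_linear S"
    and eq: "\<And>x. T (outer x x) = S (outer x x)"
  shows "T A = S A"
proof -
  have "T (outer x y) = S (outer x y)" for x y
    unfolding complex_linear_polarization [OF assms(1), of x y]
      complex_linear_polarization [OF assms(2), of x y] by (simp only: eq)
  then show ?thesis
    by (subst (1 2) matrix_eq_sum_outer) (simp add: complex_linear_simps assms)
qed

lemma eq_congruence_if_outer:
  fixes U :: "complex ^ 'm ^ 'k" and T :: "complex ^ 'm ^ 'm \<Rightarrow> complex ^ 'k ^ 'k"
  assumes "complex_linear T" "\<And>x. T (outer x x) = outer (U *v x) (U *v x)"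
  shows "T A = U ** A ** conj_transpose U"
  by (rule complex_linear_eqI [OF assms(1) complex_linear_congruence])
    (simp add: assms(2) mult_outer outer_mult)

lemma additive_homogeneous_eq_matrix:
  fixes V :: "complex ^ 'm \<Rightarrow> complex ^ 'k"
  assumes "\<And>x y. V (x + y) = V x + V y" "\<And>c x. V (c *s x) = c *s V x"
  obtains U where "V = (*v) U"
proof
  have "Vector_Spaces.linear (*s) (*s) V"
    by unfold_locales (simp_all add: assms vector_add_ldistrib vector_sadd_rdistrib)
  then show "V = (*v) (matrix V)"
    using matrix_works by (metis ext)
qed

section \<open>Orthonormal bases\<close>

text \<open>
  After multiplication by a phase \<open>c\<close>, the \<open>i\<close>-th entry of \<open>x\<close> is real, and then the Householder
  reflection in the direction \<open>w\<close> of the difference exchanges \<open>c x\<close> and the basis vector. If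
  \<open>w = 0\<close>, division by zero gives \<open>d = 0\<close>, and the reflection degenerates to the identity, as it
  should.
\<close>

lemma unitary_with_column:
  fixes x :: "complex ^ 'n"
  assumes x: "cinner x x = 1"
  obtains U where "unitary_matrix U" "U *v axis i 1 = x"
proof -
  obtain c where c: "c * cnj c = 1" "c * x $ i = complex_of_real (cmod (x $ i))"
  proof (cases "x $ i = 0")
    case True then show ?thesis using that [of 1] by simp
  next
    case False
    then show ?thesis using that [of "cnj (x $ i) / cmod (x $ i)"]
      by (simp add: complex_norm_square [symmetric] power2_eq_square [symmetric] mult.commute [of
        "cnj (x $ i)"])
         (simp add: power2_eq_square)
  qed
  define r where "r = cmod (x $ i)"
  let ?e = "axis i 1 :: complex ^ 'n"
  define w where "w = ?e - c *s x"
  define d where "d = 2 / cinner w w"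
  have ew: "cinner w ?e = complex_of_real (1 - r)"
  proof -
    have "cinner (c *s x) ?e = cnj (c * x $ i)" by (simp add: cinner_axis_right)
    then show ?thesis using c(2) by (simp add: w_def cinner_diff_left cinner_axis_right r_def)
  qed
  have ww: "cinner w w = complex_of_real (2 * (1 - r))"
  proof -
    have "cinner ?e (c *s x) = complex_of_real r" using c(2) by (simp add: cinner_axis_left r_def)
    moreover have "cinner (c *s x) (c *s x) = 1" using x c(1) by (simp add: cinner_simps mult_ac)
    ultimately have "cinner w (c *s x) = complex_of_real (r - 1)"
      by (simp add: w_def cinner_diff_left)
    moreover have "cinner w w = cinner w ?e - cinner w (c *s x)"
      by (subst (2) w_def) (simp add: cinner_diff_right)
    ultimately show ?thesis using ew by simp
  qed
  define H where "H = mat 1 - scale_matrix d (outer w w)"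
  have d: "cnj d = d" unfolding d_def ww by simp
  have H_apply: "H *v u = u - (d * cinner w u) *s w" for u
    by (simp add: H_def matrix_vector_mult_diff_rdistrib scale_matrix_mult_vec outer_mult_vec
      vector_smult_assoc)
  have H_self: "conj_transpose H = H"
    using d by (auto simp: H_def vec_eq_iff conj_transpose_component outer_def mat_def
        scale_matrix_def map_matrix_def)
  have HH: "H ** H = mat 1"
  proof -
    have "d * d * cinner w w = 2 * d" by (cases "cinner w w = 0") (simp_all add: d_def)
    then have "d * (d * (cinner w w * cinner w u)) = 2 * (d * cinner w u)" for u
      by (simp only: mult.assoc [symmetric])
    then have "d * cinner w (u - (d * cinner w u) *s w) + d * cinner w u = 0" for u
      by (simp add: cinner_simps algebra_simps)
    then have *: "d * cinner w (u - (d * cinner w u) *s w) = - (d * cinner w u)" for u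
      by (simp add: eq_neg_iff_add_eq_0)
    have "H *v (H *v u) = u" for u
      unfolding H_apply * by (simp add: vec_eq_iff)
    then show ?thesis
      by (simp add: matrix_eq matrix_vector_mul_assoc [symmetric])
  qed
  have He: "H *v ?e = c *s x"
  proof (cases "r = 1")
    case True
    then have "w = 0" using ww by simp
    then show ?thesis by (simp add: H_apply) (simp add: w_def)
  next
    case False
    then have "2 * complex_of_real (1 - r) \<noteq> 0" by (simp add: complex_eq_iff)
    then have "d * cinner w ?e = 1" unfolding d_def ww ew by (simp add: field_simps)
    then show ?thesis by (simp add: H_apply) (simp add: w_def)
  qed
  show ?thesis
  proof
    have ct: "conj_transpose (scale_matrix (cnj c) H) = scale_matrix c H"
      by (subst (2) H_self [symmetric])
         (simp add: vec_eq_iff conj_transpose_component scale_matrix_def map_matrix_def)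
    show "unitary_matrix (scale_matrix (cnj c) H)"
      unfolding unitary_matrix_def ct scale_matrix_mult HH
      using c(1) by (simp add: scale_matrix_simps mult.commute)
    show "scale_matrix (cnj c) H *v ?e = x"
      using c(1) by (simp add: scale_matrix_mult_vec He vector_smult_assoc mult.commute)
  qed
qed

lemma sum_outer_axis: "(\<Sum>i\<in>UNIV. outer (axis i 1) (axis i 1)) = (mat 1 :: complex ^ 'n ^ 'n)"
proof -
  have "scale_matrix (mat 1 $ i $ j) X = (if i = j then X else 0)"
    for i j :: 'n and X :: "complex ^ 'n ^ 'n"
    by (simp add: mat_def scale_matrix_simps)
  then show ?thesis
    by (subst matrix_eq_sum_outer [of "mat 1"]) simp
qed

lemma orthonormal_basis_extension:
  fixes x :: "complex ^ 'n"
  assumes "cinner x x = 1"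
  obtains b :: "'n \<Rightarrow> complex ^ 'n"
  where "b i = x" "\<And>k l. cinner (b k) (b l) = (if k = l then 1 else 0)"
    "(\<Sum>k\<in>UNIV. outer (b k) (b k)) = mat 1"
proof -
  obtain U where U: "unitary_matrix U" "U *v axis i 1 = x"
    using unitary_with_column assms by blast
  show ?thesis
  proof
    show "U *v axis i 1 = x" by (rule U)
    show "cinner (U *v axis k 1) (U *v axis l 1) = (if k = l then 1 else 0)" for k l
      using U(1) unfolding cinner_conj_transpose matrix_vector_mul_assoc unitary_matrix_def
      by (simp add: cinner_axis_right) (simp add: axis_def)
    have "(\<Sum>k\<in>UNIV. outer (U *v axis k 1) (U *v axis k 1)) =
        (\<Sum>k\<in>UNIV. U ** outer (axis k 1) (axis k 1) ** conj_transpose U)"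
      by (simp only: mult_outer outer_mult)
    also have "\<dots> = U ** (\<Sum>k\<in>UNIV. outer (axis k 1) (axis k 1)) ** conj_transpose U"
      by (simp only: complex_linear_sum [OF complex_linear_congruence])
    also have "\<dots> = mat 1" using U(1) by (simp add: sum_outer_axis unitary_matrix_def)
    finally show "(\<Sum>k\<in>UNIV. outer (U *v axis k 1) (U *v axis k 1)) = mat 1" .
  qed
qed

section \<open>Linear maps that preserve rank-one projections\<close>

text \<open>
  The values of a positive semidefinite form on the line \<open>z + t w\<close>, when it vanishes at \<open>z\<close>,
  have the shape below. For small \<open>t\<close> the linear terms dominate, and they change sign with \<open>t\<close>.
\<close>

lemma nonneg_form_linear_part_zero:
  fixes a b c :: complex
  assumes "\<And>t. \<exists>r\<ge>0. c * (t * cnj t) + t * a + cnj t * b = complex_of_real r"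
  shows "a = 0" "b = 0"
proof -
  have ba: "b = cnj a"
  proof -
    obtain r where r: "c + a + b = complex_of_real r" using assms[of 1] by auto
    obtain r' where r': "c - a - b = complex_of_real r'" using assms[of "-1"] by auto
    obtain s where s: "c + \<i> * a - \<i> * b = complex_of_real s" using assms[of \<i>] by auto
    obtain s' where s': "c - \<i> * a + \<i> * b = complex_of_real s'" using assms[of "-\<i>"] by auto
    show ?thesis using r r' s s' by (auto simp: complex_eq_iff)
  qed
  have "cmod a = 0"
  proof (rule ccontr)
    assume "cmod a \<noteq> 0"
    then have pos: "(cmod a)\<^sup>2 > 0" by simp
    \<comment> \<open>Along \<open>t = - s a\<^sup>*\<close> with \<open>s > 0\<close> the linear part is negative.\<close>
    have ineq: "Re c * s\<^sup>2 * (cmod a)\<^sup>2 - 2 * s * (cmod a)\<^sup>2 \<ge> 0" for s :: real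
    proof -
      obtain r where r: "r \<ge> 0" "c * ((- of_real s * cnj a) * cnj (- of_real s * cnj a))
        + (- of_real s * cnj a) * a
         + cnj (- of_real s * cnj a) * b = complex_of_real r" using assms by blast
      have "c * ((- of_real s * cnj a) * cnj (- of_real s * cnj a)) + (- of_real s * cnj a) * a
         + cnj (- of_real s * cnj a) * b = (c * of_real (s\<^sup>2) - 2 * of_real s) * (a * cnj a)"
        unfolding ba by (simp add: algebra_simps power2_eq_square)
      also have "\<dots> = (c * of_real (s\<^sup>2) - 2 * of_real s) * of_real ((cmod a)\<^sup>2)"
        by (simp only: complex_norm_square)
      finally have "r = Re ((c * of_real (s\<^sup>2) - 2 * of_real s) * of_real ((cmod a)\<^sup>2))"
        using r by (metis Re_complex_of_real)
      also have "\<dots> = Re c * s\<^sup>2 * (cmod a)\<^sup>2 - 2 * s * (cmod a)\<^sup>2"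
        by (simp add: algebra_simps)
      finally show ?thesis using r by simp
    qed
    define s where "s = 1 / (\<bar>Re c\<bar> + 1)"
    have s: "s > 0" "Re c * s \<le> 1" unfolding s_def by (auto simp: field_simps)
    have "(Re c * s - 2) * (s * (cmod a)\<^sup>2) \<ge> 0"
      using ineq[of s] by (simp add: algebra_simps power2_eq_square)
    moreover have "(Re c * s - 2) * (s * (cmod a)\<^sup>2) < 0"
      using s pos by (intro mult_neg_pos) auto
    ultimately show False by simp
  qed
  then show "a = 0" "b = 0" using ba by auto
qed

definition projection_preserving :: "(complex ^ 'm ^ 'm \<Rightarrow> complex ^ 'k ^ 'k) \<Rightarrow> bool"
  where "projection_preserving T \<longleftrightarrow> complex_linear T \<and>
    (\<forall>x. cinner x x = 1 \<longrightarrow> (\<exists>z. cinner z z = 1 \<and> T (outer x x) = outer z z)) \<and>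
    (\<forall>x y. cinner x x = 1 \<longrightarrow> cinner y y = 1 \<longrightarrow> cinner x y = 0 \<longrightarrow>
       T (outer x x) ** T (outer y y) = 0)"

lemma projection_preserving_linear: "projection_preserving T \<Longrightarrow> complex_linear T"
  by (simp add: projection_preserving_def)

lemma projection_preserving_outer:
  assumes "projection_preserving T"
  obtains z where "T (outer x x) = outer z z"
proof (cases "x = 0")
  case True
  then show ?thesis
    using that [of 0] complex_linear_zero [OF projection_preserving_linear [OF assms]] by simp
next
  case False
  then obtain c u where cu: "cinner u u = 1" "x = c *s u" using exists_unit_multiple by metis
  then obtain z where "T (outer u u) = outer z z"
    using assms unfolding projection_preserving_def by blast
  then have "T (outer x x) = outer (c *s z) (c *s z)"
    by (simp add: cu outer_scale_self complex_linear_scale [OF projection_preserving_linear [OF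
      assms]])
  then show ?thesis by (rule that)
qed

lemma projection_preserving_orthogonal:
  assumes T: "projection_preserving T" and xy: "cinner x y = 0"
  shows "T (outer x x) ** T (outer y y) = 0"
proof (cases "x = 0 \<or> y = 0")
  case True
  then show ?thesis using complex_linear_zero [OF projection_preserving_linear [OF T]] by auto
next
  case False
  then obtain c u d w where *: "c \<noteq> 0" "cinner u u = 1" "x = c *s u" "d \<noteq> 0" "cinner w w = 1"
    "y = d *s w"
    using exists_unit_multiple by metis
  then have "T (outer u u) ** T (outer w w) = 0"
    using T xy unfolding projection_preserving_def by (simp add: cinner_simps)
  then show ?thesis
    by (simp add: * outer_scale_self complex_linear_scale [OF projection_preserving_linear [OF T]]
        scale_matrix_mult scale_matrix_simps)
qed

lemma projection_preserving_transpose: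
  assumes "projection_preserving T" shows "projection_preserving (\<lambda>A. T (transpose A))"
  unfolding projection_preserving_def
proof (intro conjI allI impI)
  show "complex_linear (\<lambda>A. T (transpose A))"
    using assms projection_preserving_linear complex_linear_transpose by blast
  show "\<exists>z. cinner z z = 1 \<and> T (transpose (outer x x)) = outer z z" if "cinner x x = 1" for x
    using assms that unfolding projection_preserving_def transpose_outer
    by (simp add: cinner_cnj_vec)
  show "T (transpose (outer x x)) ** T (transpose (outer y y)) = 0" if "cinner x y = 0" for x y
    unfolding transpose_outer
    using that by (intro projection_preserving_orthogonal assms) (simp add: cinner_cnj_vec,
      metis cnj_cinner complex_cnj_zero)
qed

lemma outer_zero_if_symmetric_antisymmetric_parts_zero:
  assumes "outer a b + outer b a = 0" and "outer a b - outer b a = 0"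
  shows "a = 0 \<or> b = 0"
proof -
  have "scale_matrix 2 (outer a b) = (outer a b + outer b a) + (outer a b - outer b a)"
    using scale_matrix_simps(4) [of 1 1 "outer a b"] by (simp add: scale_matrix_simps)
  then have "scale_matrix 2 (outer a b) = 0" using assms by simp
  then show ?thesis by (simp add: scale_matrix_eq_0_iff outer_eq_0_iff)
qed

text \<open>
  The maps in question turn out to be \<open>A \<mapsto> V A V\<^sup>*\<close> and \<open>A \<mapsto> V A\<^sup>t V\<^sup>*\<close>, and this form is
  recovered from one projection \<open>e e\<^sup>*\<close>: in the first case \<open>T (x e\<^sup>*) v = V x\<close>, in the second
  \<open>T (e x\<^sup>*) v\<close> is \<open>V\<close> applied to the conjugate of \<open>x\<close>. So consider the linear map \<open>L\<close> and the
  conjugate-linear map \<open>M\<close> of the statement. A matrix \<open>z z\<^sup>*\<close> is determined by its value at \<open>v\<close>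
  when \<open>v\<^sup>* z \<noteq> 0\<close>; this gives \<open>T ((e + y) (e + y)\<^sup>*) = (v + L y + M y) (v + L y + M y)\<^sup>*\<close> for
  \<open>y\<close> orthogonal to \<open>e\<close>. Multiplying \<open>y\<close> by a phase leaves \<open>y y\<^sup>*\<close> unchanged but rotates \<open>L y\<close>
  and \<open>M y\<close> in opposite directions, so one of \<open>L y\<close> and \<open>M y\<close> is zero. Their kernels are
  subspaces that together cover the orthogonal complement of \<open>e\<close>, so one of them is all of it.
\<close>

theorem projection_preserving_form:
  fixes T :: "complex ^ 'm ^ 'm \<Rightarrow> complex ^ 'k ^ 'k"
  assumes T: "projection_preserving T" and e: "cinner e e = 1" and v: "cinner v v = 1"
    and Te: "T (outer e e) = outer v v"
  defines "L \<equiv> \<lambda>x. T (outer x e) *v v" and "M \<equiv> \<lambda>x. T (outer e x) *v v"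
  shows "(\<forall>x. T (outer x x) = outer (L x) (L x)) \<and> (\<forall>x. cinner e x = 0 \<longrightarrow> M x = 0) \<or>
         (\<forall>x. T (outer x x) = outer (M x) (M x)) \<and> (\<forall>x. cinner e x = 0 \<longrightarrow> L x = 0)"
proof -
  note lin = projection_preserving_linear [OF T]
  have L_add: "L (x + y) = L x + L y" and M_add: "M (x + y) = M x + M y"
    and L_scale: "L (c *s x) = c *s L x" and M_scale: "M (c *s x) = cnj c *s M x" for x y c
    by (simp_all add: L_def M_def outer_simps complex_linear_simps [OF lin]
        matrix_vector_mult_add_rdistrib scale_matrix_mult_vec)
  have Le: "L e = v" and Me: "M e = v"
    using v by (simp_all add: L_def M_def Te outer_mult_vec)
  have Ty_v: "T (outer y y) *v v = 0" if "cinner e y = 0" for y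
  proof -
    have "T (outer y y) ** outer v v = 0"
      using projection_preserving_orthogonal [OF T, of y e] that cnj_cinner [of e y] Te by simp
    moreover have "v \<noteq> 0" using v by auto
    ultimately show ?thesis by (simp add: mult_outer outer_eq_0_iff)
  qed
  have perp: "cinner v (L y) = 0" "cinner v (M y) = 0" if y: "cinner e y = 0" for y
  proof -
    have *: "\<exists>r\<ge>0. 1 * (t * cnj t) + t * cinner v (M y) + cnj t * cinner v (L y) =
      complex_of_real r" for t
    proof -
      obtain z where z: "T (outer (t *s e + y) (t *s e + y)) = outer z z"
        using projection_preserving_outer [OF T] by blast
      have "cinner v (T (outer (t *s e + y) (t *s e + y)) *v v) =
        t * cnj t + t * cinner v (M y) + cnj t * cinner v (L y)"
        by (simp add: outer_simps complex_linear_simps [OF lin] matrix_vector_mult_add_rdistrib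
            scale_matrix_mult_vec Te Ty_v [OF y] outer_mult_vec cinner_simps v L_def M_def
              scale_matrix_simps algebra_simps)
      moreover have "cinner v (outer z z *v v) = complex_of_real ((cmod (cinner v z))\<^sup>2)"
        by (simp only: outer_mult_vec cinner_simps complex_norm_square cnj_cinner mult.commute)
      ultimately show ?thesis using z by (intro exI [of _ "(cmod (cinner v z))\<^sup>2"]) simp
    qed
    show "cinner v (L y) = 0" "cinner v (M y) = 0"
      using nonneg_form_linear_part_zero [OF *] by auto
  qed
  \<comment> \<open>\<open>z z\<^sup>* v = c z\<close>, and \<open>|c| = 1\<close> because \<open>L y\<close> and \<open>M y\<close> are orthogonal to \<open>v\<close>.\<close>
  have shifted: "T (outer (e + y) (e + y)) =
    outer (v + L y + M y) (v + L y + M y)" if y: "cinner e y = 0" for y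
  proof -
    obtain z where z: "T (outer (e + y) (e + y)) = outer z z"
      using projection_preserving_outer [OF T] by blast
    define c where "c = cinner z v"
    have "outer z z *v v = v + L y + M y"
      unfolding z [symmetric]
      by (simp add: outer_simps complex_linear_simps [OF lin] matrix_vector_mult_add_rdistrib
            Te Ty_v [OF y] outer_mult_vec v L_def M_def)
    then have *: "c *s z = v + L y + M y" by (simp add: outer_mult_vec c_def)
    have "c * cnj c = cinner v (c *s z)"
      by (simp add: cinner_simps c_def cnj_cinner)
    also have "\<dots> = 1" unfolding * by (simp add: cinner_simps v perp [OF y])
    finally have "outer (c *s z) (c *s z) = outer z z"
      by (simp add: outer_scale_self scale_matrix_simps)
    then show ?thesis using z * by simp
  qed
  \<comment> \<open>Adding the equations for \<open>y\<close> and \<open>- y\<close> cancels the mixed terms.\<close>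
  have second_order: "T (outer y y) = outer (L y + M y) (L y + M y)" if y: "cinner e y = 0" for y
  proof -
    have y': "cinner e ((-1) *s y) = 0" using y by (simp add: cinner_simps)
    have "scale_matrix 2 (outer e e + outer y y) =
      outer (e + y) (e + y) + outer (e + (-1) *s y) (e + (-1) *s y)"
      by (simp add: vec_eq_iff outer_def scale_matrix_def map_matrix_def algebra_simps)
    from arg_cong [OF this, of T]
    have "scale_matrix 2 (outer v v + T (outer y y)) =
        outer (v + L y + M y) (v + L y + M y)
      + outer (v + L ((-1) *s y) + M ((-1) *s y)) (v + L ((-1) *s y) + M ((-1) *s y))"
      by (simp only: complex_linear_simps [OF lin] shifted [OF y] shifted [OF y'] Te)
    also have "\<dots> = scale_matrix 2 (outer v v + outer (L y + M y) (L y + M y))"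
      unfolding L_scale M_scale
      by (simp add: vec_eq_iff outer_def scale_matrix_def map_matrix_def algebra_simps)
    finally have "scale_matrix (1/2) (scale_matrix 2 (outer v v + T (outer y y))) =
       scale_matrix (1/2) (scale_matrix 2 (outer v v + outer (L y + M y) (L y + M y)))" by simp
    then show ?thesis by (simp add: scale_matrix_simps)
  qed
  \<comment> \<open>The factors \<open>\<i>\<close> and \<open>1 + \<i>\<close>, with squares \<open>- 1\<close> and \<open>2 \<i>\<close>, isolate the sum and the
    difference of \<open>(L y) (M y)\<^sup>*\<close> and \<open>(M y) (L y)\<^sup>*\<close>.\<close>
  have either: "L y = 0 \<or> M y = 0" if y: "cinner e y = 0" for y
  proof (rule outer_zero_if_symmetric_antisymmetric_parts_zero)
    have "T (outer (\<i> *s y) (\<i> *s y)) = T (outer y y)"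
      by (simp add: outer_scale_self scale_matrix_simps)
    moreover have "cinner e (\<i> *s y) = 0" using y by (simp add: cinner_simps)
    ultimately have "outer (L (\<i> *s y) + M (\<i> *s y)) (L (\<i> *s y) + M (\<i> *s y)) =
      outer (L y + M y) (L y + M y)"
      using second_order y by metis
    then have "scale_matrix 2 (outer (L y) (M y) + outer (M y) (L y)) = 0"
      unfolding L_scale M_scale
      by (simp add: vec_eq_iff outer_def scale_matrix_def map_matrix_def algebra_simps)
    then show sum0: "outer (L y) (M y) + outer (M y) (L y) = 0"
      by (simp add: scale_matrix_eq_0_iff)
    have "T (outer ((1 + \<i>) *s y) ((1 + \<i>) *s y)) = scale_matrix 2 (T (outer y y))"
      unfolding outer_scale_self complex_linear_scale [OF lin] by (simp add: algebra_simps)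
    moreover have "cinner e ((1 + \<i>) *s y) = 0" using y by (simp add: cinner_simps)
    ultimately have "outer (L ((1 + \<i>) *s y) + M ((1 + \<i>) *s y)) (L ((1 + \<i>) *s y) + M ((1
      + \<i>) *s y)) = scale_matrix 2 (outer (L y + M y) (L y + M y))"
      using second_order y by metis
    then have "scale_matrix 2 (outer (L y) (M y) + outer (M y) (L y)) =
      scale_matrix (2 * \<i>) (outer (L y) (M y) - outer (M y) (L y))"
      unfolding L_scale M_scale
      by (simp add: vec_eq_iff outer_def scale_matrix_def map_matrix_def algebra_simps)
    then have "scale_matrix (2 * \<i>) (outer (L y) (M y) - outer (M y) (L y)) = 0"
      by (metis scale_matrix_simps(8) sum0)
    then show "outer (L y) (M y) - outer (M y) (L y) = 0"
      unfolding scale_matrix_eq_0_iff by simp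
  qed
  have decomp: "\<exists>a y. x = a *s e + y \<and> cinner e y = 0" for x
    using e by (intro exI [of _ "cinner e x"] exI [of _ "x
      - cinner e x *s e"]) (simp add: cinner_simps)
  \<comment> \<open>For \<open>a \<noteq> 0\<close> the vector \<open>a e + y\<close> is a multiple of \<open>e + y / a\<close>.\<close>
  have scaled: "T (outer (a *s e + y) (a *s e + y)) =
      scale_matrix (a * cnj a) (outer (v + L ((1/a) *s y) + M ((1/a) *s y)) (v + L ((1/a) *s y)
        + M ((1/a) *s y)))"
    if "a \<noteq> 0" "cinner e y = 0" for a y
  proof -
    have "a *s e + y = a *s (e + (1/a) *s y)"
      using that by (simp add: vector_add_ldistrib vector_smult_assoc)
    moreover have "cinner e ((1/a) *s y) = 0" using that by (simp add: cinner_simps)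
    ultimately show ?thesis
      by (simp only: outer_scale_self complex_linear_scale [OF lin] shifted)
  qed
  have "(\<forall>y. cinner e y = 0 \<longrightarrow> M y = 0) \<or> (\<forall>y. cinner e y = 0 \<longrightarrow> L y = 0)"
  proof (rule ccontr)
    assume "\<not> ?thesis"
    then obtain y y' where *: "cinner e y = 0" "M y \<noteq> 0" "cinner e y' = 0" "L y' \<noteq> 0" by blast
    then have "L y = 0" "M y' = 0" using either by blast+
    then show False using either [of "y + y'"] * by (simp add: cinner_simps L_add M_add)
  qed
  then show ?thesis
  proof
    assume M0: "\<forall>y. cinner e y = 0 \<longrightarrow> M y = 0"
    have "T (outer x x) = outer (L x) (L x)" for x
    proof -
      obtain a y where x: "x = a *s e + y" and y: "cinner e y = 0" using decomp by blast
      show ?thesis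
      proof (cases "a = 0")
        case True then show ?thesis using second_order [OF y] M0 y by (simp add: x)
      next
        case False
        have "L x = a *s (v + L ((1/a) *s y))"
          using False by (simp add: x L_add L_scale Le vector_add_ldistrib vector_smult_assoc)
        then show ?thesis using scaled [OF False y] M0 y
          by (simp only: x outer_scale_self) (simp add: cinner_simps)
      qed
    qed
    then show ?thesis using M0 by blast
  next
    assume L0: "\<forall>y. cinner e y = 0 \<longrightarrow> L y = 0"
    have "T (outer x x) = outer (M x) (M x)" for x
    proof -
      obtain a y where x: "x = a *s e + y" and y: "cinner e y = 0" using decomp by blast
      show ?thesis
      proof (cases "a = 0")
        case True then show ?thesis using second_order [OF y] L0 y by (simp add: x)
      next
        case False
        have "M x = cnj a *s (v + M ((1/a) *s y))"
          using False by (simp add: x M_add M_scale Me vector_add_ldistrib vector_smult_assoc)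
        then show ?thesis using scaled [OF False y] L0 y
          by (simp only: x outer_scale_self) (simp add: cinner_simps mult.commute)
      qed
    qed
    then show ?thesis using L0 by blast
  qed
qed

section \<open>Bilinear maps that preserve rank-one projections in each factor\<close>

lemma continuous_on_outer_self: "continuous_on S (\<lambda>x :: complex ^ 'n. outer x x)"
  unfolding outer_def by (intro continuous_intros)

lemma continuous_on_matrix_vector_mult:
  fixes A :: "'a::topological_space \<Rightarrow> complex ^ 'm ^ 'n"
  assumes "continuous_on S A" "continuous_on S u"
  shows "continuous_on S (\<lambda>x. A x *v u x)"
  unfolding matrix_vector_mult_def
  by (intro continuous_intros continuous_on_vec_lambda assms)

lemma continuous_on_dichotomy_constant:
  fixes h :: "complex ^ 'm \<Rightarrow> real"
  assumes "continuous_on UNIV h" and "\<And>x. cinner x x = 1 \<Longrightarrow> h x = 0 \<or> h x = 1"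
  shows "(\<forall>x. cinner x x = 1 \<longrightarrow> h x = 0) \<or> (\<forall>x. cinner x x = 1 \<longrightarrow> h x = 1)"
proof -
  have "connected (sphere (0 :: complex ^ 'm) 1)"
    by (rule connected_sphere) (simp add: DIM_cart Suc_le_eq)
  moreover have "continuous_on (sphere 0 1) h" using assms(1) continuous_on_subset by blast
  moreover have "finite (h ` sphere 0 1)"
  proof (rule finite_subset)
    show "h ` sphere 0 1 \<subseteq> {0, 1}"
    proof
      fix r assume "r \<in> h ` sphere 0 1"
      then obtain x where "cinner x x = 1" "r = h x" by (auto simp: cinner_self_eq_1_iff)
      then show "r \<in> {0, 1}" using assms(2) by blast
    qed
  qed simp
  ultimately have "h constant_on sphere 0 1"
    by (rule continuous_finite_range_constant)
  then obtain c where "\<And>x. cinner x x = 1 \<Longrightarrow> h x = c"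
    unfolding constant_on_def by (auto simp: cinner_self_eq_1_iff)
  then show ?thesis using assms(2) by metis
qed

text \<open>
  The map \<open>\<Phi> A B\<close> stands for \<open>\<phi> (A \<otimes> B)\<close>. Keeping the two arguments apart makes transposition of
  a single factor a mere change of argument.
\<close>

locale product_projection_preserver =
  fixes \<Phi> :: "complex ^ 'm ^ 'm \<Rightarrow> complex ^ 'n ^ 'n \<Rightarrow> complex ^ 'k ^ 'k"
  assumes linear_left: "complex_linear (\<lambda>A. \<Phi> A B)"
    and linear_right: "complex_linear (\<Phi> A)"
    and left: "cinner y y = 1 \<Longrightarrow> projection_preserving (\<lambda>A. \<Phi> A (outer y y))"
    and right: "cinner x x = 1 \<Longrightarrow> projection_preserving (\<Phi> (outer x x))"

context product_projection_preserver
begin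

lemma transpose_left: "product_projection_preserver (\<lambda>A B. \<Phi> (transpose A) B)"
  by (rule product_projection_preserver.intro)
    (simp_all add: transpose_outer cinner_cnj_vec right linear_right
      complex_linear_transpose [OF linear_left] projection_preserving_transpose [OF left])

lemma transpose_right: "product_projection_preserver (\<lambda>A B. \<Phi> A (transpose B))"
  by (rule product_projection_preserver.intro)
    (simp_all add: transpose_outer cinner_cnj_vec left linear_left
      complex_linear_transpose [OF linear_right] projection_preserving_transpose [OF right])

lemma left_outer_isometry:
  assumes f: "cinner f f = 1" and V: "\<And>x. \<Phi> (outer x x) (outer f f) = outer (V x) (V x)"
  shows "cinner x x = 1 \<Longrightarrow> cinner (V x) (V x) = 1"
    and "cinner x x = 1 \<Longrightarrow> cinner x' x' = 1 \<Longrightarrow> cinner x x' = 0 \<Longrightarrow> cinner (V x) (V x') = 0"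
proof -
  show unit: "cinner (V x) (V x) = 1" if x: "cinner x x = 1" for x
  proof -
    obtain z where "cinner z z = 1" "\<Phi> (outer x x) (outer f f) = outer z z"
      using left [OF f] x unfolding projection_preserving_def by blast
    then show ?thesis using norm_eq_if_outer_self_eq [of z "V x"] V
      by (simp add: cinner_self_eq_1_iff)
  qed
  show "cinner (V x) (V x') = 0" if "cinner x x = 1" "cinner x' x' = 1" "cinner x x' = 0"
  proof -
    have "outer (V x) (V x) ** outer (V x') (V x') = 0"
      using projection_preserving_orthogonal [OF left [OF f] that(3)] by (simp add: V)
    moreover have "V x \<noteq> 0" "V x' \<noteq> 0" using unit [OF that(1)] unit [OF that(2)] by auto
    ultimately show ?thesis
      by (auto simp: outer_mult_outer scale_matrix_eq_0_iff outer_eq_0_iff)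
  qed
qed

text \<open>
  The vectors \<open>\<Phi> (x x\<^sup>*) (y f\<^sup>*) (V x)\<close> are linear in \<open>y\<close>, but \<open>x\<close> occurs in them three times.
  Linearity in \<open>x\<close> comes from an orthonormal basis that contains \<open>x\<close>: for a vector \<open>b\<close>
  orthogonal to \<open>x\<close>, the matrix \<open>\<Phi> (b b\<^sup>*) (y f\<^sup>*)\<close> has the form \<open>g (V b)\<^sup>*\<close> and so kills \<open>V x\<close>.
  Hence \<open>x x\<^sup>*\<close> can be replaced by the identity matrix, and the result is bilinear in \<open>x\<close> and
  \<open>y\<close>.
\<close>

lemma congruence_if_both_linear:
  fixes V :: "complex ^ 'm \<Rightarrow> complex ^ 'k"
  assumes f: "cinner f f = 1"
    and V_linear: "\<And>x y. V (x + y) = V x + V y" "\<And>c x. V (c *s x) = c *s V x"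
    and V: "\<And>x. \<Phi> (outer x x) (outer f f) = outer (V x) (V x)"
    and form: "\<And>x y. cinner x x = 1 \<Longrightarrow>
      \<Phi> (outer x x) (outer y y) =
        outer (\<Phi> (outer x x) (outer y f) *v V x) (\<Phi> (outer x x) (outer y f) *v V x)"
  shows "\<exists>U. \<forall>A B. \<Phi> A B = U ** (A \<otimes> B) ** conj_transpose U"
proof -
  note isometry = left_outer_isometry [OF f V]
  define G where "G x y = \<Phi> (mat 1) (outer y f) *v V x" for x y
  have G_linear: "G (x + x') y = G x y + G x' y" "G x (y + y') = G x y + G x y'"
    "G (c *s x) y = c *s G x y" "G x (c *s y) = c *s G x y" for x x' y y' c
    by (simp_all only: G_def V_linear outer_add_left outer_scale_left
        complex_linear_add [OF linear_right] complex_linear_scale [OF linear_right]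
        matrix_vector_mult_add_rdistrib matrix_vector_right_distrib scale_matrix_mult_vec vec.scale)
  have G_unit: "\<Phi> (outer x x) (outer y f) *v V x = G x y" if x: "cinner x x = 1" for x y
  proof -
    define i0 :: 'm where "i0 = undefined"
    obtain b :: "'m \<Rightarrow> complex ^ 'm" where b: "b i0 = x"
      "\<And>k l. cinner (b k) (b l) = (if k = l then 1 else 0)" "(\<Sum>k\<in>UNIV. outer (b k) (b k)) = mat 1"
      by (rule orthonormal_basis_extension [OF x, where i = i0]) blast
    have off: "\<Phi> (outer (b k) (b k)) (outer y f) *v V x = 0" if k: "k \<noteq> i0" for k
    proof -
      let ?T = "\<Phi> (outer (b k) (b k))"
      have bk: "cinner (b k) (b k) = 1" using b(2) by simp
      define L where "L y = ?T (outer y f) *v V (b k)" for y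
      have "L (x + y) = L x + L y" "L (c *s x) = c *s L x" for x y c
        by (simp_all only: L_def outer_add_left outer_scale_left complex_linear_add [OF
          linear_right]
            complex_linear_scale [OF linear_right] matrix_vector_mult_add_rdistrib
              scale_matrix_mult_vec)
      then obtain W where W: "L = (*v) W" using additive_homogeneous_eq_matrix by blast
      have "L f = V (b k)" by (simp add: L_def V outer_mult_vec isometry(1) bk)
      moreover have "?T A = W ** A ** conj_transpose W" for A
        by (rule eq_congruence_if_outer [OF linear_right]) (simp add: form [OF bk] W [symmetric]
          L_def)
      ultimately have "?T (outer y f) = outer (L y) (V (b k))"
        using W by (simp add: mult_outer outer_mult)
      moreover have "cinner (V (b k)) (V x) = 0"
        using isometry(2) [OF bk x] b(1,2) k by metis
      ultimately show ?thesis by (simp add: outer_mult_vec)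
    qed
    have "G x y = (\<Sum>k\<in>UNIV. \<Phi> (outer (b k) (b k)) (outer y f) *v V x)"
      unfolding G_def b(3) [symmetric] complex_linear_sum [OF linear_left]
      by (simp add: matrix_sum_vector_mult)
    also have "\<dots> = (\<Sum>k\<in>UNIV. if k = i0 then \<Phi> (outer x x) (outer y f) *v V x else 0)"
      by (rule sum.cong) (auto simp: off b(1))
    finally show ?thesis by simp
  qed
  have G: "\<Phi> (outer x x) (outer y y) = outer (G x y) (G x y)" for x y
  proof (cases "x = 0")
    case True
    then show ?thesis using G_linear(3) [of 0 x y] complex_linear_zero [OF linear_left] by simp
  next
    case False
    then obtain c u where u: "cinner u u = 1" "x = c *s u" using exists_unit_multiple by metis
    then show ?thesis
      using form [OF u(1)] G_unit [OF u(1)]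
      by (simp add: G_linear outer_scale_self complex_linear_scale [OF linear_left])
  qed
  define U :: "complex ^ ('m \<times> 'n) ^ 'k" where "U =
    (\<chi> r p. G (axis (fst p) 1) (axis (snd p) 1) $ r)"
  have U: "U *v tensor_vec x y = G x y" for x y
  proof -
    have right: "G x y = (\<Sum>j\<in>UNIV. y $ j *s G x (axis j 1))" for x y
    proof -
      obtain W where "G x = (*v) W"
        using additive_homogeneous_eq_matrix [of "G x"] G_linear by metis
      then show ?thesis using matrix_vector_mult_sum_basis [of W y] by simp
    qed
    have left: "G x y = (\<Sum>i\<in>UNIV. x $ i *s G (axis i 1) y)" for x y
    proof -
      obtain W where "(\<lambda>x. G x y) = (*v) W"
        using additive_homogeneous_eq_matrix [of "\<lambda>x. G x y"] G_linear by metis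
      then have "G x y = W *v x" for x by metis
      then show ?thesis using matrix_vector_mult_sum_basis [of W x] by simp
    qed
    have "G x y = (\<Sum>i\<in>UNIV. \<Sum>j\<in>UNIV. (x $ i * y $ j) *s G (axis i 1) (axis j 1))"
      by (subst left, subst right) (simp add: vec_eq_iff sum_distrib_left mult.assoc)
    then show ?thesis
      by (simp add: U_def vec_eq_iff matrix_vector_mult_def tensor_vec_def sum_UNIV_prod mult_ac)
  qed
  have lin1: "complex_linear (\<lambda>A. U ** (A \<otimes> B) ** conj_transpose U)" for B
    using complex_linear_congruence [of U] by (simp add: complex_linear_iff kronecker_simps)
  have lin2: "complex_linear (\<lambda>B. U ** (A \<otimes> B) ** conj_transpose U)" for A
    using complex_linear_congruence [of U] by (simp add: complex_linear_iff kronecker_simps)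
  have "\<Phi> (outer x x) B = U ** (outer x x \<otimes> B) ** conj_transpose U" for x B
    by (rule complex_linear_eqI [OF linear_right lin2])
      (simp add: G kronecker_outer mult_outer outer_mult U)
  then have "\<Phi> A B = U ** (A \<otimes> B) ** conj_transpose U" for A B
    by (rule complex_linear_eqI [OF linear_left lin1])
  then show ?thesis by blast
qed

text \<open>
  For each unit vector \<open>x\<close>, the map \<open>\<Phi> (x x\<^sup>*)\<close> has one of the two forms of
  \<open>projection_preserving_form\<close>. A unit vector \<open>w\<close> orthogonal to \<open>f\<close> tells them apart: the vector
  \<open>\<Phi> (x x\<^sup>*) (w f\<^sup>*) (V x)\<close> has norm \<open>1\<close> in the first case and is zero in the second. This norm
  is continuous on the unit sphere, which is connected, so the same case occurs for all \<open>x\<close>.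
\<close>

lemma congruence_if_left_linear:
  fixes V :: "complex ^ 'm \<Rightarrow> complex ^ 'k"
  assumes n: "CARD('n) \<ge> 2"
    and V_linear: "\<And>x y. V (x + y) = V x + V y" "\<And>c x. V (c *s x) = c *s V x"
    and V: "\<And>x. \<Phi> (outer x x) (outer (axis j 1) (axis j 1)) = outer (V x) (V x)"
  shows "\<exists>U \<tau>. (\<tau> = id \<or> \<tau> = transpose) \<and> (\<forall>A B. \<Phi> A B = U ** (A \<otimes> \<tau> B) ** conj_transpose U)"
proof -
  define f :: "complex ^ 'n" where "f = axis j 1"
  note V = V [folded f_def]
  have f: "cinner f f = 1" by (simp add: f_def cinner_axis_axis)
  obtain l where l: "l \<noteq> j" using n
    by (metis One_nat_def card_1_singleton_iff UNIV_eq_I Suc_1 insertI1 Suc_n_not_le_n)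
  define w :: "complex ^ 'n" where "w = axis l 1"
  have w: "cinner w w = 1" "cinner f w = 0"
    using l by (simp_all add: f_def w_def cinner_axis_axis)
  define h where "h x = norm (\<Phi> (outer x x) (outer w f) *v V x)" for x
  define P where "P x \<longleftrightarrow> (\<forall>y. \<Phi> (outer x x) (outer y y) =
    outer (\<Phi> (outer x x) (outer y f) *v V x) (\<Phi> (outer x x) (outer y f) *v V x))" for x
  define Q where "Q x \<longleftrightarrow> (\<forall>y. \<Phi> (outer x x) (outer y y) =
    outer (\<Phi> (outer x x) (outer f y) *v V x) (\<Phi> (outer x x) (outer f y) *v V x))" for x
  have dichotomy: "P x \<and> h x = 1 \<or> Q x \<and> h x = 0" if x: "cinner x x = 1" for x
  proof -
    have "P x \<or> Q x \<and> h x = 0"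
      using projection_preserving_form [OF right [OF x] f left_outer_isometry(1) [OF f V x] V] w
      unfolding P_def Q_def h_def by auto
    moreover have "h x = 1" if "P x"
    proof -
      obtain z where "cinner z z = 1" "\<Phi> (outer x x) (outer w w) = outer z z"
        using right [OF x] w unfolding projection_preserving_def by blast
      moreover from \<open>P x\<close> have "\<Phi> (outer x x) (outer w w) =
        outer (\<Phi> (outer x x) (outer w f) *v V x) (\<Phi> (outer x x) (outer w f) *v V x)"
        unfolding P_def by blast
      ultimately show ?thesis using norm_eq_if_outer_self_eq by (metis h_def cinner_self_eq_1_iff)
    qed
    ultimately show ?thesis by blast
  qed
  have "continuous_on UNIV V"
  proof -
    obtain W where "V = (*v) W" using additive_homogeneous_eq_matrix V_linear by metis
    then show ?thesis by (simp add: continuous_on_matrix_vector_mult)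
  qed
  moreover have "continuous_on UNIV (\<lambda>x. \<Phi> (outer x x) (outer w f))"
    using continuous_on_compose2 [OF linear_continuous_on [of "\<lambda>A. \<Phi> A (outer w f)" UNIV]
      continuous_on_outer_self]
      complex_linear_imp_linear [OF linear_left] linear_conv_bounded_linear by auto
  ultimately have "continuous_on UNIV h"
    unfolding h_def by (intro continuous_intros continuous_on_matrix_vector_mult)
  then consider "\<forall>x. cinner x x = 1 \<longrightarrow> h x = 0" | "\<forall>x. cinner x x = 1 \<longrightarrow> h x = 1"
    using continuous_on_dichotomy_constant dichotomy by metis
  then show ?thesis
  proof cases
    case 1
    then have Q: "Q x" if "cinner x x = 1" for x using dichotomy [OF that] that by auto
    interpret t: product_projection_preserver "\<lambda>A B. \<Phi> A (transpose B)" by (rule transpose_right)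
    have cnj_f: "cnj_vec f = f" by (simp add: f_def cnj_vec_def axis_def vec_eq_iff)
    have "\<exists>U. \<forall>A B. \<Phi> A (transpose B) = U ** (A \<otimes> B) ** conj_transpose U"
      by (rule t.congruence_if_both_linear [OF f V_linear])
        (use Q in \<open>simp_all add: transpose_outer cnj_f V Q_def\<close>)
    then obtain U where "\<And>A B. \<Phi> A (transpose B) = U ** (A \<otimes> B) ** conj_transpose U" by blast
    from this [of _ "transpose _"] have "\<Phi> A B = U ** (A \<otimes> transpose B) ** conj_transpose U" for A B
      by simp
    then show ?thesis by blast
  next
    case 2
    then have "P x" if "cinner x x = 1" for x using dichotomy [OF that] that by auto
    then have "\<exists>U. \<forall>A B. \<Phi> A B = U ** (A \<otimes> B) ** conj_transpose U"
      using congruence_if_both_linear [OF f V_linear V] unfolding P_def by blast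
    then show ?thesis by (metis id_apply)
  qed
qed

theorem congruence_form:
  assumes n: "CARD('n) \<ge> 2"
  shows "\<exists>U \<sigma> \<tau>. (\<sigma> = id \<or> \<sigma> = transpose) \<and> (\<tau> = id \<or> \<tau> = transpose) \<and>
    (\<forall>A B. \<Phi> A B = U ** (\<sigma> A \<otimes> \<tau> B) ** conj_transpose U)"
proof -
  define f :: "complex ^ 'n" where "f = axis undefined 1"
  define e :: "complex ^ 'm" where "e = axis undefined 1"
  have f: "cinner f f = 1" and e: "cinner e e = 1"
    by (simp_all add: f_def e_def cinner_axis_axis)
  obtain v where v: "cinner v v = 1" "\<Phi> (outer e e) (outer f f) = outer v v"
    using left [OF f] e unfolding projection_preserving_def by blast
  define L where "L x = \<Phi> (outer x e) (outer f f) *v v" for x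
  define M where "M x = \<Phi> (outer e x) (outer f f) *v v" for x
  have LM_linear: "L (x + y) = L x + L y" "M (x + y) = M x + M y" "L (c *s x) = c *s L x"
    "M (c *s x) = cnj c *s M x" for x y c
    by (simp_all only: L_def M_def outer_add_left outer_add_right outer_scale_left outer_scale_right
        complex_linear_add [OF linear_left] complex_linear_scale [OF linear_left]
        matrix_vector_mult_add_rdistrib scale_matrix_mult_vec)
  have "(\<forall>x. \<Phi> (outer x x) (outer f f) = outer (L x) (L x)) \<or> (\<forall>x. \<Phi> (outer x x) (outer f f) =
    outer (M x) (M x))"
    using projection_preserving_form [OF left [OF f] e v] unfolding L_def M_def by blast
  then show ?thesis
  proof
    assume "\<forall>x. \<Phi> (outer x x) (outer f f) = outer (L x) (L x)"
    then have "\<exists>U \<tau>. (\<tau> = id \<or> \<tau> = transpose) \<and> (\<forall>A B. \<Phi> A B = U ** (A \<otimes> \<tau> B) ** conj_transpose U)"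
      using congruence_if_left_linear [OF n, of L] LM_linear unfolding f_def by metis
    then show ?thesis by (metis id_apply)
  next
    assume M: "\<forall>x. \<Phi> (outer x x) (outer f f) = outer (M x) (M x)"
    interpret t: product_projection_preserver "\<lambda>A B. \<Phi> (transpose A) B" by (rule transpose_left)
    have "\<exists>U \<tau>. (\<tau> = id \<or> \<tau> = transpose) \<and> (\<forall>A B. \<Phi> (transpose A) B =
      U ** (A \<otimes> \<tau> B) ** conj_transpose U)"
    proof (rule t.congruence_if_left_linear [OF n, of "\<lambda>x. M (cnj_vec x)"])
      have "cnj_vec (x + y) = cnj_vec x + cnj_vec y" "cnj_vec (c *s x) = cnj c *s cnj_vec x"
        for x y :: "complex ^ 'm" and c
        by (simp_all add: cnj_vec_def vec_eq_iff)
      then show "M (cnj_vec (x + y)) = M (cnj_vec x) + M (cnj_vec y)"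
        "M (cnj_vec (c *s x)) = c *s M (cnj_vec x)" for x y c
        by (simp_all add: LM_linear)
      show "\<Phi> (transpose (outer x x)) (outer (axis undefined 1) (axis undefined 1)) =
        outer (M (cnj_vec x)) (M (cnj_vec x))" for x
        using M by (simp add: transpose_outer f_def)
    qed
    then obtain U \<tau> where "\<tau> = id \<or> \<tau> = transpose"
      and U: "\<And>A B. \<Phi> (transpose A) B = U ** (A \<otimes> \<tau> B) ** conj_transpose U" by blast
    moreover from U [of "transpose _"] have "\<Phi> A B = U ** (transpose A \<otimes> \<tau> B) ** conj_transpose U"
      for A B by simp
    ultimately show ?thesis by blast
  qed
qed

end

section \<open>From numerical ranges to rank-one projections\<close>

definition positive_semidefinite :: "complex ^ 'k ^ 'k \<Rightarrow> bool"
  where "positive_semidefinite X \<longleftrightarrow> (\<forall>u. \<exists>r\<ge>0. cinner u (X *v u) = complex_of_real r)"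

lemma positive_semidefinite_kernel:
  assumes X: "positive_semidefinite X" and z: "cinner z (X *v z) = 0"
  shows "X *v z = 0"
proof (rule eq_zero_if_cinner_eq_zero)
  fix w
  have *: "\<exists>r\<ge>0. cinner w (X *v w) * (t * cnj t) + t * cinner z (X *v w)
    + cnj t * cinner w (X *v z) = complex_of_real r" for t
  proof -
    have "cinner (z + t *s w) (X *v (z + t *s w)) =
        cinner w (X *v w) * (t * cnj t) + t * cinner z (X *v w) + cnj t * cinner w (X *v z)"
      by (simp add: vec.add vec.scale cinner_simps z algebra_simps)
    then show ?thesis using X unfolding positive_semidefinite_def by metis
  qed
  show "cinner w (X *v z) = 0" by (rule nonneg_form_linear_part_zero(2) [OF *])
qed

lemma matrix_eq_0_if_form_eq_0:
  assumes "\<And>u. cinner u (X *v u) = 0" shows "X = 0"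
proof -
  have "positive_semidefinite X"
    unfolding positive_semidefinite_def using assms by (metis of_real_0 order_refl)
  then have "X *v u = 0 *v u" for u
    by (simp add: positive_semidefinite_kernel [OF _ assms])
  then show ?thesis by (simp add: matrix_eq)
qed

lemma positive_semidefinite_hermitian:
  assumes "positive_semidefinite X" shows "conj_transpose X = X"
proof -
  have "cinner u ((conj_transpose X - X) *v u) = 0" for u
  proof -
    obtain r where r: "cinner u (X *v u) = complex_of_real r"
      using assms unfolding positive_semidefinite_def by blast
    have "cinner u (conj_transpose X *v u) = cinner (X *v u) u"
      by (simp add: cinner_conj_transpose)
    also have "\<dots> = cnj (cinner u (X *v u))" by (simp add: cnj_cinner)
    finally show ?thesis using r by (simp add: matrix_vector_mult_diff_rdistrib cinner_simps)
  qed
  from matrix_eq_0_if_form_eq_0 [OF this] show ?thesis by simp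
qed

text \<open>
  The number of matrices \<open>X p\<close> is their size. Since the forms of all \<open>X q\<close> at \<open>z p\<close> are
  nonnegative and add up to \<open>1\<close>, and \<open>X p\<close> already contributes \<open>1\<close>, all others vanish at \<open>z p\<close>.
  So \<open>X p\<close> fixes \<open>z p\<close> and kills the other \<open>z q\<close>; being Hermitian, it makes the \<open>z p\<close> an
  orthonormal family, which is a basis because there are enough of them.
\<close>

lemma resolution_into_rank_one_projections:
  fixes X :: "'k \<Rightarrow> complex ^ 'k ^ 'k"
  assumes psd: "\<And>p. positive_semidefinite (X p)" and sum: "(\<Sum>p\<in>UNIV. X p) = mat 1"
    and z: "\<And>p. cinner (z p) (z p) = 1" "\<And>p. cinner (z p) (X p *v z p) = 1"
  shows "X p = outer (z p) (z p)"
proof -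
  have form_nonneg: "\<exists>r\<ge>0. cinner u (X q *v u) = complex_of_real r" for u q
    using psd unfolding positive_semidefinite_def by blast
  have form: "Re (cinner u (X q *v u)) \<ge> 0"
    "cinner u (X q *v u) = complex_of_real (Re (cinner u (X q *v u)))" for u q
    using form_nonneg [of u q] by auto
  have sum_form: "(\<Sum>q\<in>UNIV. X q *v u) = u" for u
    by (simp add: matrix_sum_vector_mult [symmetric] sum)
  have off: "X q *v z p = 0" if "q \<noteq> p" for p q
  proof -
    have "(\<Sum>q\<in>UNIV. cinner (z p) (X q *v z p)) = cinner (z p) (\<Sum>q\<in>UNIV. X q *v z p)"
      unfolding cinner_def by (simp add: sum_distrib_left) (rule sum.swap)
    also have "\<dots> = 1" by (simp add: sum_form z)
    finally have "(\<Sum>q\<in>UNIV. Re (cinner (z p) (X q *v z p))) = 1"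
      by (metis Re_sum one_complex.simps(1))
    then have "(\<Sum>q\<in>UNIV - {p}. Re (cinner (z p) (X q *v z p))) = 0"
      by (simp add: sum.remove [of UNIV p] z(2))
    then have "Re (cinner (z p) (X q *v z p)) = 0"
      using that form(1) by (subst (asm) sum_nonneg_eq_0_iff) auto
    then show ?thesis using form(2) [of "z p" q] positive_semidefinite_kernel [OF psd] by simp
  qed
  have on: "X p *v z p = z p" for p
  proof -
    have "z p = (\<Sum>q\<in>UNIV. if q = p then X p *v z p else 0)"
      by (subst sum_form [symmetric, of "z p"], rule sum.cong) (auto simp: off)
    then show ?thesis by simp
  qed
  have orth: "cinner (z p) (z q) = (if p = q then 1 else 0)" for p q
  proof -
    have "cinner (z p) (z q) = cinner (z p) (X q *v z q)" by (simp add: on)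
    also have "\<dots> = cinner (X q *v z p) (z q)"
      by (simp add: cinner_conj_transpose positive_semidefinite_hermitian [OF psd])
    finally show ?thesis using z off by auto
  qed
  define Z where "Z = (\<chi> i p. z p $ i)"
  have Z_axis: "Z *v axis p 1 = z p" for p
    by (simp add: Z_def vec_eq_iff matrix_vector_mult_def axis_def if_distrib [where f =
      "\<lambda>x. _ * x"] cong: if_cong)
  have "conj_transpose Z ** Z = mat 1"
    using orth by (simp add: vec_eq_iff matrix_matrix_mult_def conj_transpose_component Z_def
      cinner_def mat_def)
  then have ZZ: "Z ** conj_transpose Z = mat 1" using matrix_left_right_inverse by blast
  have "X p *v (Z *v axis q 1) = outer (z p) (axis p 1) *v axis q 1" for q
    by (simp add: Z_axis outer_mult_vec cinner_axis_axis on off)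
  then have "(X p ** Z) *v u = outer (z p) (axis p 1) *v u" for u
    by (subst (1 2) matrix_vector_mult_sum_basis) (simp add: matrix_vector_mul_assoc)
  then have "X p ** Z = outer (z p) (axis p 1)" by (simp add: matrix_eq)
  then have "X p ** Z ** conj_transpose Z = outer (z p) (z p)" by (simp add: outer_mult Z_axis)
  then show ?thesis by (simp add: matrix_mul_assoc [symmetric] ZZ)
qed

lemma form_in_unit_interval:
  assumes "numerical_range X \<subseteq> complex_of_real ` {0..1}"
  shows "\<exists>r. 0 \<le> r \<and> r \<le> (norm u)\<^sup>2 \<and> cinner u (X *v u) = complex_of_real r"
proof (cases "u = 0")
  case True then show ?thesis by simp
next
  case False
  then obtain c w where w: "cinner w w = 1" "u = c *s w" using exists_unit_multiple by metis
  then have "cinner w (X *v w) \<in> complex_of_real ` {0..1}"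
    using assms unfolding numerical_range_def by blast
  then obtain r where r: "0 \<le> r" "r \<le> 1" "cinner w (X *v w) = complex_of_real r" by auto
  have c: "cnj c * c = complex_of_real ((cmod c)\<^sup>2)"
    by (simp only: complex_norm_square mult.commute)
  have "complex_of_real ((norm u)\<^sup>2) = complex_of_real ((cmod c)\<^sup>2)"
    unfolding cinner_self [symmetric] c [symmetric] w(2) by (simp add: cinner_simps w(1))
  then have u: "(norm u)\<^sup>2 = (cmod c)\<^sup>2" by (simp only: of_real_eq_iff)
  have "cinner u (X *v u) = (cnj c * c) * complex_of_real r"
    by (simp add: w(2) vec.scale cinner_simps r(3))
  then have "cinner u (X *v u) = complex_of_real ((cmod c)\<^sup>2 * r)" by (simp add: c)
  moreover have "(cmod c)\<^sup>2 * r \<le> (norm u)\<^sup>2" unfolding u using r by (simp add: mult_left_le)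
  ultimately show ?thesis using r by (intro exI [of _ "(cmod c)\<^sup>2 * r"]) simp
qed

lemma positive_semidefinite_if_numerical_range:
  "numerical_range X \<subseteq> complex_of_real ` {0..1} \<Longrightarrow> positive_semidefinite X"
  unfolding positive_semidefinite_def using form_in_unit_interval by blast

text \<open>
  Bessel's inequality; the case \<open>q = 0\<close> covers a single projection.
\<close>

lemma numerical_range_two_projections:
  assumes p: "cinner p p = 1" and q: "cinner q q = 1 \<or> q = 0" and pq: "cinner p q = 0"
  shows "numerical_range (outer p p + outer q q) \<subseteq> complex_of_real ` {0..1}"
proof
  fix z assume "z \<in> numerical_range (outer p p + outer q q)"
  then obtain u where u: "cinner u u = 1" and z: "z = cinner u ((outer p p + outer q q) *v u)"
    unfolding numerical_range_def by blast
  define a where "a = cinner p u"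
  define b where "b = cinner q u"
  have cnj_ab: "cinner u p = cnj a" "cinner u q = cnj b" by (simp_all add: a_def b_def cnj_cinner)
  have qp: "cinner q p = 0" using pq cnj_cinner [of p q] by simp
  have ab: "cnj a * a = complex_of_real ((cmod a)\<^sup>2)" "cnj b * b = complex_of_real ((cmod b)\<^sup>2)"
    by (simp_all only: complex_norm_square mult.commute)
  have "z = cnj a * a + cnj b * b"
    by (simp add: z matrix_vector_mult_add_rdistrib outer_mult_vec cinner_simps cnj_ab
      a_def [symmetric] b_def [symmetric] mult.commute)
  then have z: "z = complex_of_real ((cmod a)\<^sup>2 + (cmod b)\<^sup>2)" by (simp add: ab)
  let ?w = "u - a *s p - b *s q"
  have bq: "b * cnj b * cinner q q = b * cnj b" using q by (auto simp: b_def)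
  have "cinner ?w ?w = 1 - (cnj a * a + cnj b * b)"
    using bq by (simp add: cinner_simps u p pq qp cnj_ab a_def [symmetric] b_def [symmetric]
      algebra_simps)
  also have "\<dots> = complex_of_real (1 - ((cmod a)\<^sup>2 + (cmod b)\<^sup>2))" by (simp add: ab)
  finally have "(norm ?w)\<^sup>2 = 1 - ((cmod a)\<^sup>2 + (cmod b)\<^sup>2)" unfolding cinner_self of_real_eq_iff .
  then have "(cmod a)\<^sup>2 + (cmod b)\<^sup>2 \<le> 1" by (metis zero_le_power2 diff_ge_0_iff_ge)
  then show "z \<in> complex_of_real ` {0..1}" unfolding z by (intro imageI) simp
qed

text \<open>
  At \<open>z\<close> the form of \<open>z z\<^sup>*\<close> is already \<open>1\<close>, which leaves no room for \<open>w w\<^sup>*\<close>.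
\<close>

lemma orthogonal_if_numerical_range:
  assumes "numerical_range (outer z z + outer w w) \<subseteq> complex_of_real ` {0..1}"
    and z: "cinner z z = 1"
  shows "outer z z ** outer w w = 0"
proof -
  obtain r where r: "r \<le> (norm z)\<^sup>2" "cinner z ((outer z z + outer w w) *v z) = complex_of_real r"
    using form_in_unit_interval [OF assms(1)] by blast
  have "cinner z ((outer z z + outer w w) *v z) = 1 + cinner w z * cinner z w"
    by (simp add: matrix_vector_mult_add_rdistrib outer_mult_vec cinner_simps z)
  also have "\<dots> = complex_of_real (1 + (cmod (cinner z w))\<^sup>2)"
    using complex_norm_square [of "cinner z w"] by (simp add: cnj_cinner mult.commute)
  finally have "r = 1 + (cmod (cinner z w))\<^sup>2" using r(2) by (simp only: of_real_eq_iff)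
  then have "(cmod (cinner z w))\<^sup>2 \<le> 0" using r(1) z by (simp add: cinner_self_eq_1_iff)
  then have "cinner z w = 0" by simp
  then show ?thesis by (simp add: outer_mult_outer scale_matrix_simps)
qed

lemma numerical_range_preserver_unital:
  fixes \<phi> :: "complex ^ ('m::finite \<times> 'n::finite) ^ ('m \<times> 'n) \<Rightarrow> complex ^ ('m \<times> 'n) ^ ('m \<times> 'n)"
  assumes "\<And>A B. numerical_range (\<phi> (A \<otimes> B)) = numerical_range (A \<otimes> B)"
  shows "\<phi> (mat 1) = mat 1"
proof -
  have range: "numerical_range (\<phi> (mat 1)) =
    numerical_range (mat 1 :: complex ^ ('m \<times> 'n) ^ ('m \<times> 'n))"
    using assms [of "mat 1" "mat 1"] by (simp add: kronecker_mat_1)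
  have "cinner u (\<phi> (mat 1) *v u) = cinner u u" for u
  proof (cases "u = 0")
    case False
    then obtain c w where w: "cinner w w = 1" "u = c *s w" using exists_unit_multiple by metis
    then have "cinner w (\<phi> (mat 1) *v w) \<in> numerical_range (mat 1 :: complex ^ ('m \<times> 'n) ^ ('m \<times>
      'n))"
      unfolding range [symmetric] by (auto simp: numerical_range_def)
    then have "cinner w (\<phi> (mat 1) *v w) = 1"
      unfolding numerical_range_def by auto
    then show ?thesis by (simp add: w vec.scale cinner_simps)
  qed simp
  then have "\<phi> (mat 1) - mat 1 = 0"
    by (intro matrix_eq_0_if_form_eq_0) (simp add: matrix_vector_mult_diff_rdistrib cinner_simps)
  then show ?thesis by simp
qed

text \<open>
  Complete \<open>x\<close> and \<open>y\<close> to orthonormal bases: the products of the corresponding projections add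
  up to the identity matrix, and their numerical ranges are contained in \<open>[0, 1]\<close> and contain
  \<open>1\<close>. These properties pass to the images, to which \<open>resolution_into_rank_one_projections\<close>
  applies.
\<close>

lemma numerical_range_preserver_projection:
  fixes \<phi> :: "complex ^ ('m::finite \<times> 'n::finite) ^ ('m \<times> 'n) \<Rightarrow> complex ^ ('m \<times> 'n) ^ ('m \<times> 'n)"
  assumes lin: "complex_linear \<phi>"
    and W: "\<And>A B. numerical_range (\<phi> (A \<otimes> B)) = numerical_range (A \<otimes> B)"
    and x: "cinner x x = 1" and y: "cinner y y = 1"
  shows "\<exists>z. cinner z z = 1 \<and> \<phi> (outer x x \<otimes> outer y y) = outer z z"
proof -
  define i :: 'm where "i = undefined"
  define j :: 'n where "j = undefined"
  obtain b :: "'m \<Rightarrow> complex ^ 'm" where b: "b i = x"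
    "\<And>k l. cinner (b k) (b l) = (if k = l then 1 else 0)" "(\<Sum>k\<in>UNIV. outer (b k) (b k)) = mat 1"
    by (rule orthonormal_basis_extension [OF x, where i = i]) blast
  obtain c :: "'n \<Rightarrow> complex ^ 'n" where c: "c j = y"
    "\<And>k l. cinner (c k) (c l) = (if k = l then 1 else 0)" "(\<Sum>k\<in>UNIV. outer (c k) (c k)) = mat 1"
    by (rule orthonormal_basis_extension [OF y, where i = j]) blast
  define E where "E p = outer (b (fst p)) (b (fst p)) \<otimes> outer (c (snd p)) (c (snd p))" for p
  have E_outer: "E p = outer (tensor_vec (b (fst p)) (c (snd p))) (tensor_vec (b (fst p)) (c (snd
    p)))" for p
    by (simp add: E_def kronecker_outer)
  have unit: "cinner (tensor_vec (b k) (c l)) (tensor_vec (b k) (c l)) = 1" for k l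
    by (simp add: cinner_tensor b c)
  have W_E: "numerical_range (\<phi> (E p)) = numerical_range (E p)" for p by (simp add: E_def W)
  have psd: "positive_semidefinite (\<phi> (E p))" for p
    using numerical_range_two_projections [OF unit, of 0]
    by (intro positive_semidefinite_if_numerical_range) (simp only: W_E, simp add: E_outer)
  have "\<exists>z. cinner z z = 1 \<and> cinner z (\<phi> (E p) *v z) = 1" for p
  proof -
    let ?v = "tensor_vec (b (fst p)) (c (snd p))"
    have "cinner ?v (E p *v ?v) = 1" by (simp add: E_outer outer_mult_vec cinner_simps unit)
    then have "1 \<in> numerical_range (E p)" unfolding numerical_range_def using unit by force
    then have "1 \<in> numerical_range (\<phi> (E p))" by (simp add: W_E)
    then show ?thesis unfolding numerical_range_def by force
  qed
  then obtain z where z: "\<And>p. cinner (z p) (z p) = 1"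
    "\<And>p. cinner (z p) (\<phi> (E p) *v z p) = 1" by metis
  have "(\<Sum>p\<in>UNIV. E p) = mat 1"
  proof -
    have l: "A \<otimes> (\<Sum>l\<in>L. B l) = (\<Sum>l\<in>L. A \<otimes> B l)"
      for A :: "complex ^ 'm ^ 'm" and B :: "'n \<Rightarrow> complex ^ 'n ^ 'n" and L
      by (induction L rule: infinite_finite_induct) (simp_all add: kronecker_simps,
        simp_all add: kronecker_product_def vec_eq_iff)
    have r: "(\<Sum>l\<in>L. A l) \<otimes> B = (\<Sum>l\<in>L. A l \<otimes> B)"
      for A :: "'m \<Rightarrow> complex ^ 'm ^ 'm" and B :: "complex ^ 'n ^ 'n" and L
      by (induction L rule: infinite_finite_induct) (simp_all add: kronecker_simps,
        simp_all add: kronecker_product_def vec_eq_iff)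
    show ?thesis by (simp add: sum_UNIV_prod E_def l [symmetric] c r [symmetric] b kronecker_mat_1)
  qed
  then have "(\<Sum>p\<in>UNIV. \<phi> (E p)) = mat 1"
    using numerical_range_preserver_unital [of \<phi>, OF W]
      by (simp add: complex_linear_sum [OF lin, symmetric])
  from resolution_into_rank_one_projections [OF psd this z]
  have "\<phi> (E (i, j)) = outer (z (i, j)) (z (i, j))" .
  then show ?thesis using z(1) by (auto simp: E_def b c)
qed

text \<open>
  Orthogonality of two product projections that share a factor is visible in the numerical range
  of their sum, which is again a tensor product.
\<close>

theorem numerical_range_preserver_product_projection:
  fixes \<phi> :: "complex ^ ('m::finite \<times> 'n::finite) ^ ('m \<times> 'n) \<Rightarrow> complex ^ ('m \<times> 'n) ^ ('m \<times> 'n)"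
  assumes lin: "complex_linear \<phi>"
    and W: "\<And>A B. numerical_range (\<phi> (A \<otimes> B)) = numerical_range (A \<otimes> B)"
  shows "product_projection_preserver (\<lambda>A B. \<phi> (A \<otimes> B))"
proof -
  note proj = numerical_range_preserver_projection [OF lin W]
  have linear_left: "complex_linear (\<lambda>A. \<phi> (A \<otimes> B))"
    and linear_right: "complex_linear (\<lambda>B. \<phi> (A \<otimes> B))" for A B
    using lin by (simp_all add: complex_linear_iff kronecker_simps)
  show ?thesis
  proof (rule product_projection_preserver.intro [OF linear_left linear_right])
    fix y :: "complex ^ 'n" assume y: "cinner y y = 1"
    show "projection_preserving (\<lambda>A. \<phi> (A \<otimes> outer y y))"
      unfolding projection_preserving_def
    proof (intro conjI allI impI linear_left)
      show "\<exists>z. cinner z z = 1 \<and> \<phi> (outer x x \<otimes> outer y y) = outer z z" if "cinner x x = 1" for x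
        using proj that y by blast
      fix x x' :: "complex ^ 'm"
      assume x: "cinner x x = 1" and x': "cinner x' x' = 1" and orth: "cinner x x' = 0"
      obtain z z' where z: "cinner z z = 1" "\<phi> (outer x x \<otimes> outer y y) = outer z z"
        "\<phi> (outer x' x' \<otimes> outer y y) = outer z' z'" using proj x x' y by metis
      have "outer z z + outer z' z' = \<phi> ((outer x x + outer x' x') \<otimes> outer y y)"
        by (simp add: kronecker_simps complex_linear_add [OF lin] z)
      then have "numerical_range (outer z z + outer z' z') =
        numerical_range ((outer x x + outer x' x') \<otimes> outer y y)"
        by (simp only: W)
      also have "\<dots> \<subseteq> complex_of_real ` {0..1}"
        unfolding kronecker_simps kronecker_outer
        by (rule numerical_range_two_projections) (simp_all add: cinner_tensor x x' y orth)
      finally show "\<phi> (outer x x \<otimes> outer y y) ** \<phi> (outer x' x' \<otimes> outer y y) = 0"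
        unfolding z(2,3) by (rule orthogonal_if_numerical_range [OF _ z(1)])
    qed
  next
    fix x :: "complex ^ 'm" assume x: "cinner x x = 1"
    show "projection_preserving (\<lambda>B. \<phi> (outer x x \<otimes> B))"
      unfolding projection_preserving_def
    proof (intro conjI allI impI linear_right)
      show "\<exists>z. cinner z z = 1 \<and> \<phi> (outer x x \<otimes> outer y y) = outer z z" if "cinner y y = 1" for y
        using proj that x by blast
      fix y y' :: "complex ^ 'n"
      assume y: "cinner y y = 1" and y': "cinner y' y' = 1" and orth: "cinner y y' = 0"
      obtain z z' where z: "cinner z z = 1" "\<phi> (outer x x \<otimes> outer y y) = outer z z"
        "\<phi> (outer x x \<otimes> outer y' y') = outer z' z'" using proj x y y' by metis
      have "outer z z + outer z' z' = \<phi> (outer x x \<otimes> (outer y y + outer y' y'))"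
        by (simp add: kronecker_simps complex_linear_add [OF lin] z)
      then have "numerical_range (outer z z + outer z' z') =
        numerical_range (outer x x \<otimes> (outer y y + outer y' y'))"
        by (simp only: W)
      also have "\<dots> \<subseteq> complex_of_real ` {0..1}"
        unfolding kronecker_simps kronecker_outer
        by (rule numerical_range_two_projections) (simp_all add: cinner_tensor x y' y orth)
      finally show "\<phi> (outer x x \<otimes> outer y y) ** \<phi> (outer x x \<otimes> outer y' y') = 0"
        unfolding z(2,3) by (rule orthogonal_if_numerical_range [OF _ z(1)])
    qed
  qed
qed

section \<open>Numerical ranges under congruence and transposition\<close>

lemma numerical_range_subset_congruence:
  assumes U: "unitary_matrix U"
  shows "numerical_range (U ** X ** conj_transpose U) \<subseteq> numerical_range X"
proof
  fix z assume "z \<in> numerical_range (U ** X ** conj_transpose U)"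
  then obtain u where u: "cinner u u = 1" "z = cinner u (U *v (X *v (conj_transpose U *v u)))"
    unfolding numerical_range_def by (auto simp: matrix_vector_mul_assoc matrix_mul_assoc)
  have "cinner (conj_transpose U *v u) (conj_transpose U *v u) = 1"
    using U u(1) by (simp add: cinner_conj_transpose matrix_vector_mul_assoc unitary_matrix_def)
  moreover have "z = cinner (conj_transpose U *v u) (X *v (conj_transpose U *v u))"
    unfolding u(2) by (rule cinner_conj_transpose)
  ultimately show "z \<in> numerical_range X" unfolding numerical_range_def by blast
qed

lemma numerical_range_congruence:
  assumes U: "unitary_matrix U"
  shows "numerical_range (U ** X ** conj_transpose U) = numerical_range X"
proof
  have "unitary_matrix (conj_transpose U)" using U by (simp add: unitary_matrix_def)
  moreover have "X = conj_transpose U ** (U ** X ** conj_transpose U) ** conj_transpose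
    (conj_transpose U)"
  proof -
    have "conj_transpose U ** (U ** X ** conj_transpose U) ** U =
        (conj_transpose U ** U) ** X ** (conj_transpose U ** U)" by (simp add: matrix_mul_assoc)
    then show ?thesis using U by (simp add: unitary_matrix_def)
  qed
  ultimately show "numerical_range X \<subseteq> numerical_range (U ** X ** conj_transpose U)"
    using numerical_range_subset_congruence by metis
qed (rule numerical_range_subset_congruence [OF U])

lemma numerical_range_transpose: "numerical_range (transpose X) = numerical_range X"
proof -
  have form: "cinner u (transpose X *v u) = cinner (cnj_vec u) (X *v cnj_vec u)"
    for X :: "complex ^ 'k ^ 'k" and u
    by (simp add: cinner_def matrix_vector_mult_def transpose_def cnj_vec_def sum_distrib_left
      mult_ac)
      (rule sum.swap)
  have sub: "numerical_range (transpose X) \<subseteq> numerical_range X" for X :: "complex ^ 'k ^ 'k"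
  proof
    fix z assume "z \<in> numerical_range (transpose X)"
    then obtain u where u: "cinner u u = 1" "z = cinner (cnj_vec u) (X *v cnj_vec u)"
      unfolding numerical_range_def form by blast
    then have "cinner (cnj_vec u) (cnj_vec u) = 1" by (simp add: cinner_cnj_vec)
    then show "z \<in> numerical_range X" unfolding u numerical_range_def by blast
  qed
  show ?thesis using sub [of X] sub [of "transpose X"] by simp
qed

lemma unitary_kronecker:
  "unitary_matrix V \<Longrightarrow> unitary_matrix W \<Longrightarrow> unitary_matrix (V \<otimes> W)"
  by (simp add: unitary_matrix_def conj_transpose_kronecker kronecker_mult kronecker_mat_1)

lemma numerical_range_kronecker_congruence:
  assumes "unitary_matrix V" "unitary_matrix W"
  shows "numerical_range ((V ** A ** conj_transpose V) \<otimes> (W ** B ** conj_transpose W)) =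
    numerical_range (A \<otimes> B)"
  using numerical_range_congruence [OF unitary_kronecker [OF assms], of "A \<otimes> B"]
  by (simp add: conj_transpose_kronecker kronecker_mult)

text \<open>
  Two real linear equations in three real unknowns.
\<close>

lemma two_real_equations_solvable:
  fixes a b c :: complex
  obtains x y t :: real where "x\<^sup>2 + y\<^sup>2 + t\<^sup>2 = 1"
    "of_real x * a + of_real y * b + of_real t * c = 0"
proof -
  have "\<exists>x y t :: real. (x, y, t) \<noteq> (0, 0, 0) \<and> of_real x * a + of_real y * b + of_real t * c = 0"
  proof (cases "a = 0")
    case True
    then show ?thesis by (intro exI [of _ 1] exI [of _ 0]) simp
  next
    case False
    show ?thesis
    proof (cases "Re a * Im b - Re b * Im a = 0")
      case True
      have "(Re a)\<^sup>2 + (Im a)\<^sup>2 \<noteq> 0" using False by (metis complex_neq_0 less_irrefl)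
      moreover have "of_real (- (Re a * Re b + Im a * Im b)) * a + of_real ((Re a)\<^sup>2
        + (Im a)\<^sup>2) * b = 0"
        using True by (simp add: complex_eq_iff power2_eq_square) algebra
      ultimately show ?thesis
        by (intro exI [of _ "- (Re a * Re b + Im a * Im b)"] exI [of _ "(Re a)\<^sup>2
          + (Im a)\<^sup>2"] exI [of _ 0]) (simp del: sum_power2_eq_zero_iff)
    next
      case False
      then show ?thesis
        \<comment> \<open>the cross product of the coefficient vectors of the two equations\<close>
        by (intro exI [of _ "Re b * Im c - Re c * Im b"] exI [of _ "Re c * Im a - Re a * Im c"]
            exI [of _ "Re a * Im b - Re b * Im a"]) (simp add: complex_eq_iff algebra_simps)
    qed
  qed
  then obtain x y t :: real where *: "(x, y, t) \<noteq> (0, 0, 0)"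
    "of_real x * a + of_real y * b + of_real t * c = 0" by blast
  define N where "N = sqrt (x\<^sup>2 + y\<^sup>2 + t\<^sup>2)"
  have pos: "x\<^sup>2 + y\<^sup>2 + t\<^sup>2 > 0"
  proof -
    have "x\<^sup>2 + y\<^sup>2 + t\<^sup>2 \<noteq> 0" using *(1) by (auto simp: add_nonneg_eq_0_iff)
    then show ?thesis by (metis add_nonneg_nonneg zero_le_power2 less_eq_real_def)
  qed
  then have N: "N > 0" "N\<^sup>2 = x\<^sup>2 + y\<^sup>2 + t\<^sup>2" by (simp_all add: N_def)
  show ?thesis
  proof
    show "(x / N)\<^sup>2 + (y / N)\<^sup>2 + (t / N)\<^sup>2 = 1"
      using N pos by (simp add: power_divide add_divide_distrib [symmetric])
    have "of_real (x / N) * a + of_real (y / N) * b + of_real (t / N) * c =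
        (of_real x * a + of_real y * b + of_real t * c) / of_real N"
      by (simp add: add_divide_distrib)
    then show "of_real (x / N) * a + of_real (y / N) * b + of_real (t / N) * c = 0"
      using *(2) by simp
  qed
qed

text \<open>
  The ansatz \<open>V = (z, t; t, -z\<^sup>*)\<close> with \<open>t\<close> real and \<open>|z|\<^sup>2 + t\<^sup>2 = 1\<close> gives a unitary matrix.
  Because \<open>V\<close> is symmetric, \<open>V A = A\<^sup>t V\<close> says only that \<open>V A\<close> is symmetric, which is one
  complex equation, linear over the reals in the three real parameters \<open>Re z\<close>, \<open>Im z\<close> and \<open>t\<close>.
\<close>

lemma two_by_two_unitarily_similar_transpose:
  fixes A :: "complex ^ 'k ^ 'k"
  assumes "CARD('k) = 2"
  obtains V where "unitary_matrix V" "transpose A = V ** A ** conj_transpose V"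
proof -
  obtain i j :: 'k where ij: "i \<noteq> j" "UNIV = {i, j}" using assms by (metis card_2_iff)
  then have ji: "j \<noteq> i" by simp
  have all: "(\<forall>k. P k) \<longleftrightarrow> P i \<and> P j" for P by (metis ij(2) UNIV_I insertE emptyE)
  obtain x y t :: real where xyt: "x\<^sup>2 + y\<^sup>2 + t\<^sup>2 = 1"
    "of_real x * (A $ i $ j + A $ j $ i) + of_real y * (\<i> * (A $ i $ j - A $ j $ i))
      + of_real t * (A $ j $ j - A $ i $ i) = 0"
    by (rule two_real_equations_solvable)
  define z where "z = Complex x y"
  have z: "z = of_real x + \<i> * of_real y" "cnj z = of_real x - \<i> * of_real y"
    by (simp_all add: z_def complex_eq_iff)
  have "of_real (x\<^sup>2 + y\<^sup>2 + t\<^sup>2) = (1 :: complex)" by (simp only: xyt(1) of_real_1)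
  then have norm1: "z * cnj z + of_real t * of_real t = 1"
    unfolding z by (simp add: algebra_simps power2_eq_square)
  have eq: "z * A $ i $ j + cnj z * A $ j $ i = of_real t * (A $ i $ i - A $ j $ j)"
    using xyt(2) unfolding z by (simp add: algebra_simps)
  define V :: "complex ^ 'k ^ 'k" where
    "V = (\<chi> k l. if k = l then if k = i then z else - cnj z else of_real t)"
  have V: "V $ i $ i = z" "V $ j $ j = - cnj z" "V $ i $ j = of_real t" "V $ j $ i = of_real t"
    using ij by (auto simp: V_def)
  have sum: "(\<Sum>k\<in>UNIV. g k) = g i + g j" for g :: "'k \<Rightarrow> complex"
    using ij(1) by (simp add: ij(2))
  have unitary: "unitary_matrix V"
    using norm1 ij(1) ji
    by (simp add: unitary_matrix_def vec_eq_iff all matrix_matrix_mult_def sum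
        conj_transpose_component V mat_def algebra_simps)
  have "V ** A = transpose A ** V"
    using eq by (simp add: vec_eq_iff all matrix_matrix_mult_def transpose_def sum V algebra_simps)
  then have "V ** A ** conj_transpose V = transpose A ** (V ** conj_transpose V)"
    by (simp add: matrix_mul_assoc)
  also have "\<dots> = transpose A" using unitary by (simp add: unitary_matrix_def)
  finally show ?thesis using that unitary by metis
qed

section \<open>A partial transposition that changes the numerical range\<close>

lemma three_distinct_elements:
  assumes "CARD('k::finite) \<ge> 3"
  obtains a b c :: "'k::finite" where "a \<noteq> b" "a \<noteq> c" "b \<noteq> c"
proof -
  obtain S :: "'k set" where "card S = 3" using obtain_subset_with_card_n [OF assms] by blast
  then show ?thesis using that by (auto simp: card_3_iff)
qed

lemma cinner_outer_axis: "cinner u (outer (axis p 1) (axis q 1) *v u) = cnj (u $ p) * u $ q"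
  by (simp add: outer_mult_vec cinner_simps cinner_axis_left cinner_axis_right mult.commute)

lemma tensor_axis: "tensor_vec (axis i 1) (axis j 1) = axis (i, j) 1"
  by (auto simp: tensor_vec_def axis_def vec_eq_iff)

text \<open>
  In both factors take the weighted shift with weights \<open>1\<close> and \<open>2\<close>. The product of the shifts
  has the chain of weights \<open>1\<close>, \<open>4\<close>, whereas the product of one shift with the transpose of the
  other has only the chain \<open>2\<close>, \<open>2\<close> and isolated weights \<open>1\<close>, \<open>4\<close>. The numerical radii are
  \<open>\<surd>17 / 2\<close>, which is greater than \<open>2\<close>, and \<open>2\<close>. The vector with entries \<open>1, 4, 4\<close> on the chain
  \<open>1\<close>, \<open>4\<close> is close enough to the maximizer \<open>1, \<surd>17, 4\<close> to show the difference.
\<close>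

lemma kronecker_partial_transpose_range_differs:
  assumes "CARD('m::finite) \<ge> 3" "CARD('n::finite) \<ge> 3"
  shows "\<exists>(A :: complex ^ 'm::finite ^ 'm) (B :: complex ^ 'n::finite ^ 'n).
    numerical_range (A \<otimes> transpose B) \<noteq> numerical_range (A \<otimes> B)"
proof -
  obtain a1 a2 a3 :: 'm where a: "a1 \<noteq> a2" "a1 \<noteq> a3" "a2 \<noteq> a3"
    using three_distinct_elements [OF assms(1)] by blast
  obtain b1 b2 b3 :: 'n where b: "b1 \<noteq> b2" "b1 \<noteq> b3" "b2 \<noteq> b3"
    using three_distinct_elements [OF assms(2)] by blast
  define A :: "complex ^ 'm ^ 'm"
    where "A = outer (axis a1 1) (axis a2 1) + scale_matrix 2 (outer (axis a2 1) (axis a3 1))"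
  define B :: "complex ^ 'n ^ 'n"
    where "B = outer (axis b1 1) (axis b2 1) + scale_matrix 2 (outer (axis b2 1) (axis b3 1))"
  have Bt: "transpose B = outer (axis b2 1) (axis b1 1)
    + scale_matrix 2 (outer (axis b3 1) (axis b2 1))"
    by (auto simp: B_def vec_eq_iff transpose_def outer_def scale_matrix_def map_matrix_def
      axis_def)
  have form: "cinner u ((A \<otimes> B) *v u) = cnj (u $ (a1, b1)) * u $ (a2, b2)
      + 2 * (cnj (u $ (a1, b2)) * u $ (a2, b3)) + 2 * (cnj (u $ (a2, b1)) * u $ (a3, b2))
      + 4 * (cnj (u $ (a2, b2)) * u $ (a3, b3))" for u
    by (simp add: A_def B_def kronecker_simps kronecker_outer tensor_axis scale_matrix_simps
        matrix_vector_mult_add_rdistrib cinner_simps scale_matrix_mult_vec cinner_outer_axis)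
  have form_t: "cinner u ((A \<otimes> transpose B) *v u) = cnj (u $ (a1, b2)) * u $ (a2, b1)
      + 2 * (cnj (u $ (a1, b3)) * u $ (a2, b2)) + 2 * (cnj (u $ (a2, b2)) * u $ (a3, b1))
      + 4 * (cnj (u $ (a2, b3)) * u $ (a3, b2))" for u
    by (simp add: A_def Bt kronecker_simps kronecker_outer tensor_axis scale_matrix_simps
        matrix_vector_mult_add_rdistrib cinner_simps scale_matrix_mult_vec cinner_outer_axis)
  define w :: "complex ^ ('m \<times> 'n)" where
    "w = axis (a1, b1) 1 + 4 *s axis (a2, b2) 1 + 4 *s axis (a3, b3) 1"
  define u where "u = complex_of_real (1 / sqrt 33) *s w"
  have ww: "cinner w w = 33"
    using a b by (simp add: w_def cinner_simps cinner_axis_axis)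
  have s33: "complex_of_real (1 / sqrt 33) * complex_of_real (1 / sqrt 33) = 1 / 33"
    by (simp flip: of_real_mult)
  have uu: "cinner u u = 1"
    unfolding u_def cinner_simps ww using s33 by (simp add: mult.assoc [symmetric])
  have "cinner w ((A \<otimes> B) *v w) = 68"
    unfolding form using a b by (simp add: w_def axis_def)
  then have "cinner u ((A \<otimes> B) *v u) = 68 / 33"
    unfolding u_def vec.scale cinner_simps using s33 by (simp add: mult.assoc [symmetric])
  then have mem: "68 / 33 \<in> numerical_range (A \<otimes> B)"
    unfolding numerical_range_def using uu by force
  have "68 / 33 \<notin> numerical_range (A \<otimes> transpose B)"
  proof
    assume "68 / 33 \<in> numerical_range (A \<otimes> transpose B)"
    then obtain u where u: "cinner u u = 1" "68 / 33 = cinner u ((A \<otimes> transpose B) *v u)"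
      unfolding numerical_range_def by blast
    define n where "n k l = cmod (u $ (k, l))" for k l
    have "cmod (68 / 33) \<le> n a1 b2 * n a2 b1 + 2 * (n a1 b3 * n a2 b2) + 2 * (n a2 b2 * n a3 b1)
      + 4 * (n a2 b3 * n a3 b2)"
      unfolding u(2) form_t n_def
      by (intro norm_triangle_le add_mono) (simp_all add: norm_mult)
    \<comment> \<open>The arithmetic-geometric mean inequality in each product: \<open>n a2 b2\<close> occurs in two products
      with factor \<open>2\<close>, the entries of the isolated weight \<open>4\<close> in one with factor \<open>4\<close>, so every
      square receives a coefficient of at most \<open>2\<close>.\<close>
    also have "\<dots> \<le> 2 * ((n a1 b2)\<^sup>2 + (n a2 b1)\<^sup>2 + (n a1 b3)\<^sup>2 + (n a2 b2)\<^sup>2 + (n a3 b1)\<^sup>2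
      + (n a2 b3)\<^sup>2 + (n a3 b2)\<^sup>2)"
    proof -
      have amgm: "p * q \<le> (p\<^sup>2 + q\<^sup>2) / 2" for p q :: real
        using sum_squares_bound [of p q] by simp
      show ?thesis
        using amgm [of "n a1 b2" "n a2 b1"] amgm [of "n a1 b3" "n a2 b2"] amgm [of "n a2 b2"
          "n a3 b1"]
          amgm [of "n a2 b3" "n a3 b2"] zero_le_power2 [of "n a1 b2"] zero_le_power2 [of "n a2 b1"]
          zero_le_power2 [of "n a1 b3"] zero_le_power2 [of "n a3 b1"]
        unfolding distrib_left add_divide_distrib by linarith
    qed
    also have "\<dots> = 2 * (\<Sum>p\<in>{(a1, b2), (a2, b1), (a1, b3), (a2, b2), (a3, b1), (a2, b3), (a3,
      b2)}. (cmod (u $ p))\<^sup>2)"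
      using a b by (simp add: n_def)
    also have "\<dots> \<le> 2 * (\<Sum>p\<in>UNIV. (cmod (u $ p))\<^sup>2)"
      by (intro mult_left_mono sum_mono2) auto
    also have "(\<Sum>p\<in>UNIV. (cmod (u $ p))\<^sup>2) = 1"
    proof -
      have "norm u = 1" using u(1) by (simp add: cinner_self_eq_1_iff)
      then show ?thesis by (simp add: norm_vec_def L2_set_def)
    qed
    finally show False by (simp add: norm_divide)
  qed
  then show ?thesis using mem by metis
qed

section \<open>Preservers of the numerical range of tensor products\<close>

theorem theorem2p2:
  fixes \<phi> :: "complex ^ ('m::finite \<times> 'n::finite) ^ ('m \<times> 'n) \<Rightarrow> complex ^ ('m \<times> 'n) ^ ('m \<times> 'n)"
  assumes "CARD('m) \<ge> 2" and "CARD('n) \<ge> 2"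
    and "complex_linear \<phi>"
  shows "(\<forall>(A :: complex ^ 'm ^ 'm) (B :: complex ^ 'n ^ 'n).
            numerical_range (\<phi> (A \<otimes> B)) = numerical_range (A \<otimes> B))
     \<longleftrightarrow>
     (\<exists>(U :: complex ^ ('m \<times> 'n) ^ ('m \<times> 'n))
        (\<phi>1 :: complex ^ 'm ^ 'm \<Rightarrow> complex ^ 'm ^ 'm)
        (\<phi>2 :: complex ^ 'n ^ 'n \<Rightarrow> complex ^ 'n ^ 'n).
        unitary_matrix U \<and>
        (\<phi>1 = id \<or> \<phi>1 = transpose) \<and> (\<phi>2 = id \<or> \<phi>2 = transpose) \<and>
        (\<forall>A B. \<phi> (A \<otimes> B) = U ** (\<phi>1 A \<otimes> \<phi>2 B) ** conj_transpose U) \<and>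
        (CARD('m) \<ge> 3 \<and> CARD('n) \<ge> 3 \<longrightarrow>
           (\<phi>1 = id \<and> \<phi>2 = id) \<or> (\<phi>1 = transpose \<and> \<phi>2 = transpose)))"
    (is "?preserves \<longleftrightarrow> ?form")
proof
  assume ?preserves
  then have W: "numerical_range (\<phi> (A \<otimes> B)) = numerical_range (A \<otimes> B)" for A B by blast
  interpret product_projection_preserver "\<lambda>A B. \<phi> (A \<otimes> B)"
    by (rule numerical_range_preserver_product_projection [OF assms(3) W])
  obtain U :: "complex ^ ('m \<times> 'n) ^ ('m \<times> 'n)" and \<sigma> \<tau> where
    \<sigma>: "\<sigma> = id \<or> \<sigma> = transpose" and \<tau>: "\<tau> = id \<or> \<tau> = transpose"
    and U: "\<And>A B. \<phi> (A \<otimes> B) = U ** (\<sigma> A \<otimes> \<tau> B) ** conj_transpose U"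
    using congruence_form [OF assms(2)] by blast
  have "\<sigma> (mat 1) = mat 1" "\<tau> (mat 1) = mat 1" using \<sigma> \<tau> by (auto simp: transpose_mat)
  then have "U ** conj_transpose U = mat 1"
    using U [of "mat 1" "mat 1"] numerical_range_preserver_unital [of \<phi>, OF W]
    by (simp add: kronecker_mat_1)
  then have unitary: "unitary_matrix U"
    using matrix_left_right_inverse unfolding unitary_matrix_def by blast
  have range: "numerical_range (\<sigma> A \<otimes> \<tau> B) = numerical_range (A \<otimes> B)" for A B
    using W [of A B] unfolding U numerical_range_congruence [OF unitary] .
  \<comment> \<open>Either mixed type would make partial transposition preserve all numerical ranges, since the
    full transposition does.\<close>
  have same: "(\<sigma> = id \<and> \<tau> = id) \<or> (\<sigma> = transpose \<and> \<tau> = transpose)"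
    if "CARD('m) \<ge> 3 \<and> CARD('n) \<ge> 3"
  proof (rule ccontr)
    assume "\<not> ?thesis"
    then consider "\<sigma> = id" "\<tau> = transpose" | "\<sigma> = transpose" "\<tau> = id" using \<sigma> \<tau> by blast
    then have "numerical_range (A \<otimes> transpose B) = numerical_range (A \<otimes> B)"
      for A :: "complex ^ 'm ^ 'm" and B :: "complex ^ 'n ^ 'n"
    proof cases
      case 1 then show ?thesis using range [of A B] by simp
    next
      case 2
      have "numerical_range (A \<otimes> transpose B) = numerical_range (transpose A \<otimes> B)"
        using numerical_range_transpose [of "A \<otimes> transpose B"] by (simp add: transpose_kronecker)
      then show ?thesis using range [of A B] 2 by simp
    qed
    then show False using kronecker_partial_transpose_range_differs that by blast
  qed
  show ?form
    by (rule exI [of _ U], rule exI [of _ \<sigma>], rule exI [of _ \<tau>]) (use unitary \<sigma> \<tau> U same in blast)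
next
  assume ?form
  then obtain U :: "complex ^ ('m \<times> 'n) ^ ('m \<times> 'n)" and \<sigma> \<tau> where unitary: "unitary_matrix U"
    and \<sigma>: "\<sigma> = id \<or> \<sigma> = transpose" and \<tau>: "\<tau> = id \<or> \<tau> = transpose"
    and U: "\<And>A B. \<phi> (A \<otimes> B) = U ** (\<sigma> A \<otimes> \<tau> B) ** conj_transpose U"
    and same: "CARD('m) \<ge> 3 \<and> CARD('n) \<ge> 3 \<Longrightarrow> (\<sigma> = id \<and> \<tau> = id) \<or> (\<sigma> = transpose \<and> \<tau> = transpose)"
    by blast
  have both_transposed: "numerical_range (transpose A \<otimes> transpose B) = numerical_range (A \<otimes> B)"
    for A :: "complex ^ 'm ^ 'm" and B :: "complex ^ 'n ^ 'n"
    using numerical_range_transpose [of "A \<otimes> B"] by (simp add: transpose_kronecker)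
  have one: "unitary_matrix (mat 1)"
    by (simp add: unitary_matrix_def conj_transpose_mat_1)
  have partial: "numerical_range (A \<otimes> transpose B) = numerical_range (A \<otimes> B)"
    if small: "CARD('m) = 2 \<or> CARD('n) = 2"
      for A :: "complex ^ 'm ^ 'm" and B :: "complex ^ 'n ^ 'n"
    using small
  proof
    assume "CARD('m) = 2"
    then obtain V where V: "unitary_matrix V" "transpose A = V ** A ** conj_transpose V"
      by (rule two_by_two_unitarily_similar_transpose)
    have "numerical_range (A \<otimes> transpose B) = numerical_range (transpose A \<otimes> transpose B)"
      using numerical_range_kronecker_congruence [OF V(1) one, of A "transpose B"]
      by (simp add: V(2) conj_transpose_mat_1)
    then show ?thesis by (simp only: both_transposed)
  next
    assume "CARD('n) = 2"
    then obtain V where V: "unitary_matrix V" "transpose B = V ** B ** conj_transpose V"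
      by (rule two_by_two_unitarily_similar_transpose)
    show ?thesis
      using numerical_range_kronecker_congruence [OF one V(1), of A B]
      by (simp add: V(2) conj_transpose_mat_1)
  qed
  have "numerical_range (\<sigma> A \<otimes> \<tau> B) = numerical_range (A \<otimes> B)" for A B
  proof (cases "(\<sigma> = id \<and> \<tau> = id) \<or> (\<sigma> = transpose \<and> \<tau> = transpose)")
    case True then show ?thesis using both_transposed by auto
  next
    case False
    then have "CARD('m) = 2 \<or> CARD('n) = 2" using same assms by fastforce
    note partial = partial [OF this]
    from False consider "\<sigma> = id" "\<tau> = transpose" | "\<sigma> = transpose" "\<tau> = id" using \<sigma> \<tau> by blast
    then show ?thesis
    proof cases
      case 1 then show ?thesis using partial by simp
    next
      case 2 then show ?thesis using partial [of "transpose A" B] both_transposed [of A B] by simp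
    qed
  qed
  then show ?preserves unfolding U numerical_range_congruence [OF unitary] by blast
qed

end
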